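(* Let $(\varGamma,C)$ be a split-step SUSYQW with anisotropic coin $C$, and for $\sharp\in\{\mathrm L,\mathrm R\}$ let $U_\sharp=\varGamma\,\big(\bigoplus_{x\in\mathbb Z}C(\sharp)\big)$, i.e. $\varGamma$ composed with the constant coin equal to $C(\sharp)$ at every site. Then the essential spectrum of $U=\varGamma C$ is $\sigma_{\mathrm{ess}}(U)=\sigma(U_{\mathrm L})\cup\sigma(U_{\mathrm R})$, and $\sigma(U_\sharp)=\{z\in\mathbb C:|z|=1,\ \operatorname{Re}z\in I_\sharp\}$, where $I_\sharp=\{\pm1\}$ if $C(\sharp)$ is trivial and $I_\sharp=[\,p\,a(\sharp)-|q\,b(\sharp)|,\ p\,a(\sharp)+|q\,b(\sharp)|\,]$ otherwise.
   Context: Let $L$ be the left shift $(L\Psi)(x)=\Psi(x+1)$ on $\ell^2(\mathbb Z)$. A split-step SUSYQW is $\varGamma=\begin{pmatrix} p & qL\\ \overline{q}L^* & -p\end{pmatrix}$, $C=\begin{pmatrix} a_1 & \overline{b}\\ b & a_2\end{pmatrix}$ on $\ell^2(\mathbb Z,\mathbb C^2)\cong\ell^2(\mathbb Z)\oplus\ell^2(\mathbb Z)$ with $p\in\mathbb R$, $q\in\mathbb C\setminus\{0\}$, $p^2+|q|^2=1$, real sequences $a_1,a_2$ and complex sequence $b$ with $a_j(x)^2+|b(x)|^2=1$, $b(x)(a_1(x)+a_2(x))=0$. $C$ is anisotropic if $C(\mathrm L)=\lim_{x\to-\infty}C(x)$ and $C(\mathrm R)=\lim_{x\to+\infty}C(x)$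 exist, where $C(x)=\begin{pmatrix} a_1(x)&\overline{b(x)}\\ b(x)&a_2(x)\end{pmatrix}$; $b(\sharp)$ denotes the lower-left entry of $C(\sharp)$. A $2\times 2$ unitary Hermitian matrix is trivial if it equals $\pm I$; if $C(\sharp)$ is nontrivial then $a_1(\sharp)=-a_2(\sharp)=:a(\sharp)$. *)

theory Defs
  imports "HOL-Analysis.Analysis"
begin

text \<open>States in l2(Z, C^2), represented as functions Z -> C x C
  (first component = upper component, second = lower component).\<close>
type_synonym state = "int \<Rightarrow> complex \<times> complex"

definition l2 :: "state set" where
  "l2 = {\<psi>. (\<lambda>x. (norm (\<psi> x))\<^sup>2) summable_on UNIV}"

definition csmult :: "complex \<Rightarrow> complex \<times> complex \<Rightarrow> complex \<times> complex" where
  "csmult z v = (z * fst v, z * snd v)"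

text \<open>Split-step shift operator Gamma = [[p, q L],[conj q L^*, -p]],
  with (L psi)(x) = psi(x+1), (L^* psi)(x) = psi(x-1).\<close>
definition Gam :: "real \<Rightarrow> complex \<Rightarrow> state \<Rightarrow> state" where
  "Gam p q \<psi> = (\<lambda>x. (complex_of_real p * fst (\<psi> x) + q * snd (\<psi> (x + 1)),
                     cnj q * fst (\<psi> (x - 1)) - complex_of_real p * snd (\<psi> x)))"

definition Coin :: "(int \<Rightarrow> real) \<Rightarrow> (int \<Rightarrow> real) \<Rightarrow> (int \<Rightarrow> complex) \<Rightarrow> state \<Rightarrow> state" where
  "Coin a1 a2 b \<psi> = (\<lambda>x. (complex_of_real (a1 x) * fst (\<psi> x) + cnj (b x) * snd (\<psi> x),
                          b x * fst (\<psi> x) + complex_of_real (a2 x) * snd (\<psi> x)))"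

text \<open>Spectrum of an operator T on l2: z such that T - z is not a bijection of l2
  (for bounded operators this is equivalent to non-invertibility in B(l2)).\<close>
definition spec :: "(state \<Rightarrow> state) \<Rightarrow> complex set" where
  "spec T = {z. \<not> bij_betw (\<lambda>\<psi> x. T \<psi> x - csmult z (\<psi> x)) l2 l2}"

definition eigenspace :: "(state \<Rightarrow> state) \<Rightarrow> complex \<Rightarrow> state set" where
  "eigenspace T z = {\<psi> \<in> l2. T \<psi> = (\<lambda>x. csmult z (\<psi> x))}"

definition fin_dim :: "state set \<Rightarrow> bool" where
  "fin_dim E \<longleftrightarrow> (\<exists>F. finite F \<and> (\<forall>\<psi>\<in>E. \<exists>c. \<psi> = (\<lambda>x. \<Sum>\<phi>\<in>F. csmult (c \<phi>) (\<phi> x))))"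

definition disc_spec :: "(state \<Rightarrow> state) \<Rightarrow> complex set" where
  "disc_spec T = {z \<in> spec T. (\<exists>e>0. ball z e \<inter> spec T = {z})
                 \<and> eigenspace T z \<noteq> {\<lambda>_. (0, 0)} \<and> fin_dim (eigenspace T z)}"

definition ess_spec :: "(state \<Rightarrow> state) \<Rightarrow> complex set" where
  "ess_spec T = spec T - disc_spec T"

definition trivial_coin :: "real \<Rightarrow> real \<Rightarrow> complex \<Rightarrow> bool" where
  "trivial_coin a1 a2 b \<longleftrightarrow> b = 0 \<and> ((a1 = 1 \<and> a2 = 1) \<or> (a1 = -1 \<and> a2 = -1))"

text \<open>The interval I for a limit coin with entries a1, a2, b (a = a1 in the nontrivial case).\<close>
definition I_set :: "real \<Rightarrow> complex \<Rightarrow> real \<Rightarrow> real \<Rightarrow> complex \<Rightarrow> real set" where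
  "I_set p q a1 a2 b = (if trivial_coin a1 a2 b then {-1, 1}
                        else {p * a1 - norm (q * b) .. p * a1 + norm (q * b)})"

end

theory Submission
  imports Defs "HOL-Library.Function_Algebras"
begin

text \<open>
  Weyl's criterion without functional calculus. Write \<open>T = U - z\<close> with \<open>|z| = 1\<close>.

  If \<open>z\<close> is isolated in the spectrum of the unitary operator \<open>U\<close>, then the symmetric operator
  \<open>G = T\<^sup>* T\<close> has a spectral gap above \<open>0\<close>, which amounts to \<open>G\<^sup>2 \<ge> \<epsilon> G\<close>. The iteration
  \<open>x \<mapsto> x - G x / 4\<close> then moves every approximate eigenvector to a nearby exact one. A weakly null
  sequence of unit vectors cannot stay close to a finite-dimensional kernel, so \<open>z\<close> is in the
  essential spectrum as soon as there is a weakly null sequence of approximate eigenvectors.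
  Conversely, \<open>z\<close> is not in the essential spectrum if \<open>T\<close> is bounded below modulo a compact operator.

  For a constant coin, \<open>U + U\<^sup>*\<close> is a scalar combination of shifts, so \<open>T\<close> is bounded below when
  \<open>Re z\<close> lies outside the band. Inside the band there is a plane wave; its truncations to longer and
  longer blocks, moved towards \<open>-\<infinity>\<close> or \<open>+\<infinity>\<close>, form a weakly null sequence of approximate
  eigenvectors of the anisotropic walk. If \<open>z\<close> is in neither limit spectrum, then \<open>T\<close> is bounded
  below on states that vanish on a large finite box, and cutting off to that box is a compact
  operator.
\<close>

section \<open>Operators that are bounded below\<close>

definition bounded_below :: "('a::real_normed_vector \<Rightarrow> 'b::real_normed_vector) \<Rightarrow> bool" where
  "bounded_below f \<longleftrightarrow> (\<exists>c>0. \<forall>x. c * norm x \<le> norm (f x))"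

lemma bounded_belowI:
  assumes "c > 0" "\<And>x. c * norm x \<le> norm (f x)"
  shows "bounded_below f"
  using assms unfolding bounded_below_def by blast

lemma bounded_below_compose:
  assumes "bounded_below f" "bounded_below g"
  shows "bounded_below (\<lambda>x. f (g x))"
proof -
  obtain c where c_pos: "c > 0" and f_ge: "\<And>x. c * norm x \<le> norm (f x)"
    using assms(1) unfolding bounded_below_def by blast
  obtain d where d_pos: "d > 0" and g_ge: "\<And>x. d * norm x \<le> norm (g x)"
    using assms(2) unfolding bounded_below_def by blast
  show ?thesis
  proof (rule bounded_belowI)
    show "c * d > 0" using c_pos d_pos by simp
    fix x
    have "c * d * norm x \<le> c * norm (g x)" using c_pos g_ge by (simp add: mult.assoc)
    also have "\<dots> \<le> norm (f (g x))" by (rule f_ge)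
    finally show "c * d * norm x \<le> norm (f (g x))" .
  qed
qed

lemma not_bounded_belowE:
  assumes "linear f" "\<not> bounded_below f" "e > 0"
  obtains x where "norm x = 1" "norm (f x) < e"
proof -
  obtain x where small: "norm (f x) < e * norm x"
    using assms by (meson bounded_belowI not_less)
  then have "norm x > 0" using \<open>e > 0\<close> by (cases "x = 0") auto
  moreover have "norm (f ((1 / norm x) *\<^sub>R x)) = norm (f x) / norm x"
    by (simp add: linear_scale[OF \<open>linear f\<close>])
  ultimately show thesis
    using small by (intro that[of "(1 / norm x) *\<^sub>R x"]) (auto simp: pos_divide_less_eq)
qed

lemma bij_add_lipschitz:
  fixes S K :: "'a::banach \<Rightarrow> 'a"
  assumes "bij S" and expanding: "\<And>x y. c * norm (x - y) \<le> norm (S x - S y)"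
    and lipschitz: "\<And>x y. norm (K x - K y) \<le> d * norm (x - y)" and "0 \<le> d" "d < c"
  shows "bij (\<lambda>x. S x + K x)"
proof (rule bijI)
  show "inj (\<lambda>x. S x + K x)"
  proof (rule injI)
    fix x y assume "S x + K x = S y + K y"
    then have "S x - S y = K y - K x" by (simp add: algebra_simps)
    then have "(c - d) * norm (x - y) \<le> 0"
      using expanding[of x y] lipschitz[of y x] by (simp add: norm_minus_commute left_diff_distrib)
    then show "x = y" using \<open>d < c\<close> by (simp add: mult_le_0_iff)
  qed
  have "\<exists>x. y = S x + K x" for y
  proof -
    define f where "f x = inv S (y - K x)" for x
    have S_f: "S (f x) = y - K x" for x
      using \<open>bij S\<close> by (simp add: f_def surj_f_inv_f bij_is_surj)
    have "dist (f x) (f x') \<le> d / c * dist x x'" for x x'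
    proof -
      have "c * norm (f x - f x') \<le> norm (K x - K x')"
        using expanding[of "f x" "f x'"] by (simp add: S_f norm_minus_commute)
      also have "\<dots> \<le> d * norm (x - x')" by (rule lipschitz)
      finally show ?thesis using \<open>0 \<le> d\<close> \<open>d < c\<close> by (simp add: dist_norm field_simps)
    qed
    then obtain x where "f x = x"
      using banach_fix_type[of "d / c" f] \<open>0 \<le> d\<close> \<open>d < c\<close> by auto
    then show ?thesis using S_f[of x] by (intro exI[of _ x]) simp
  qed
  then show "surj (\<lambda>x. S x + K x)" unfolding surj_def by blast
qed

lemma Baire_closed_cover:
  fixes A :: "nat \<Rightarrow> 'a::complete_space set"
  assumes "\<And>n. closed (A n)" "(\<Union>n. A n) = UNIV"
  obtains n where "interior (A n) \<noteq> {}"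
proof -
  have "Met_TC.mcomplete TYPE('a)"
    by (auto simp: Met_TC.mcomplete_def Cauchy_convergent_iff convergent_def)
  then show thesis
    using Met_TC.metric_Baire_category_alt[of "range A"] assms that by auto
qed

lemma uniform_boundedness:
  fixes f :: "'i \<Rightarrow> 'a::banach \<Rightarrow> 'b::real_normed_vector"
  assumes linear: "\<And>i. i \<in> I \<Longrightarrow> bounded_linear (f i)"
    and pointwise: "\<And>x. \<exists>B. \<forall>i\<in>I. norm (f i x) \<le> B"
  shows "\<exists>B. \<forall>i\<in>I. \<forall>x. norm (f i x) \<le> B * norm x"
proof -
  define A where "A n = (\<Inter>i\<in>I. {x. norm (f i x) \<le> real n})" for n
  have closed: "closed (A n)" for n
    unfolding A_def
    by (intro closed_INT ballI closed_Collect_le continuous_on_norm continuous_on_const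
        linear_continuous_on linear)
  have "\<exists>n. x \<in> A n" for x
  proof -
    obtain B where B: "\<forall>i\<in>I. norm (f i x) \<le> B" using pointwise by blast
    obtain n where "B \<le> real n" using real_arch_simple by blast
    then have "x \<in> A n" using B by (auto simp: A_def intro: order_trans)
    then show ?thesis ..
  qed
  then have "(\<Union>n. A n) = UNIV" by blast
  then obtain n where "interior (A n) \<noteq> {}" by (rule Baire_closed_cover[OF closed])
  then obtain a r where r_pos: "r > 0" and ball: "cball a r \<subseteq> A n"
    by (metis ex_in_conv mem_interior_cball)
  have "norm (f i x) \<le> 2 * real n / r * norm x" if i: "i \<in> I" for i x
  proof (cases "x = 0")
    case True
    then show ?thesis using linear_0[OF bounded_linear.linear[OF linear[OF i]]] by simp
  next
    case False
    interpret f: bounded_linear "f i" by (rule linear[OF i])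
    define y where "y = (r / norm x) *\<^sub>R x"
    have "a \<in> A n" "a + y \<in> A n" using r_pos ball False by (auto simp: y_def dist_norm)
    then have "norm (f i a) \<le> n" "norm (f i (a + y)) \<le> n" using i by (auto simp: A_def)
    then have "norm (f i y) \<le> 2 * real n"
      using norm_triangle_ineq4[of "f i (a + y)" "f i a"] by (simp add: f.add)
    then show ?thesis using r_pos False by (simp add: y_def f.scaleR field_simps)
  qed
  then show ?thesis by blast
qed

lemma surj_imp_adjoint_bounded_below:
  fixes f :: "'a::real_inner \<Rightarrow> 'b::{real_inner,banach}"
  assumes adjoint: "\<And>x y. inner (f x) y = inner x (g y)" and "linear g" "surj f"
  shows "bounded_below g"
proof -
  have "\<exists>B. \<forall>y\<in>{y. norm (g y) \<le> 1}. norm (inner y x) \<le> B" for x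
  proof -
    obtain v where v: "x = f v" using \<open>surj f\<close> by (meson surjD)
    have "norm (inner y x) \<le> norm v" if "norm (g y) \<le> 1" for y
    proof -
      have "inner y x = inner v (g y)" by (simp add: v inner_commute[of y] adjoint)
      then show ?thesis
        using Cauchy_Schwarz_ineq2[of v "g y"] mult_left_mono[OF that, of "norm v"] by simp
    qed
    then show ?thesis by blast
  qed
  then obtain B where inner_le: "\<And>y x. norm (g y) \<le> 1 \<Longrightarrow> norm (inner y x) \<le> B * norm x"
    using uniform_boundedness[of "{y. norm (g y) \<le> 1}" inner] bounded_linear_inner_right by blast
  show ?thesis
  proof (rule ccontr)
    assume "\<not> bounded_below g"
    then obtain x where unit: "norm x = 1" and small: "norm (g x) < 1 / (\<bar>B\<bar> + 1)"
      by (rule not_bounded_belowE[OF \<open>linear g\<close>, of "1 / (\<bar>B\<bar> + 1)"]) auto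
    define y where "y = (\<bar>B\<bar> + 1) *\<^sub>R x"
    have "norm (g y) \<le> 1"
      unfolding y_def linear_scale[OF \<open>linear g\<close>] norm_scaleR
      using small by (simp add: pos_less_divide_eq mult.commute)
    then have "norm y * norm y \<le> B * norm y"
      using inner_le[of y y] by (simp add: dot_square_norm power2_eq_square)
    moreover have norm_y: "norm y = \<bar>B\<bar> + 1" using unit by (simp add: y_def)
    ultimately have "norm y \<le> B" by (intro mult_right_le_imp_le[of "norm y" "norm y" B]) auto
    then show False using norm_y by simp
  qed
qed

section \<open>Descent and spectral gaps of symmetric operators\<close>

lemma Cauchy_if_dist_le_null_sequence:
  fixes u :: "nat \<Rightarrow> 'a::metric_space"
  assumes dist_le: "\<And>n k. dist (u n) (u (n + k)) \<le> e n" and null: "e \<longlonglongrightarrow> 0"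
  shows "Cauchy u"
  unfolding Cauchy_altdef
proof (intro allI impI)
  fix d :: real assume "d > 0"
  then obtain N where small: "\<And>n. n \<ge> N \<Longrightarrow> e n < d"
    using order_tendstoD(2)[OF null] unfolding eventually_sequentially by blast
  have "dist (u m) (u n) < d" if "m \<ge> N" "n > m" for m n
    using dist_le[of m "n - m"] small[OF \<open>m \<ge> N\<close>] \<open>n > m\<close> by simp
  then show "\<exists>M. \<forall>m\<ge>M. \<forall>n>m. dist (u m) (u n) < d" by blast
qed

lemma dist_funpow_le_descent:
  fixes f :: "'a::metric_space \<Rightarrow> 'a"
  assumes "\<And>x. dist x (f x) \<le> L * (g x - g (f x))"
  shows "dist x ((f ^^ n) x) \<le> L * (g x - g ((f ^^ n) x))"
proof (induction n)
  case (Suc n)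
  have "dist x ((f ^^ Suc n) x) \<le> dist x ((f ^^ n) x) + dist ((f ^^ n) x) ((f ^^ Suc n) x)"
    by (rule dist_triangle)
  also have "\<dots> \<le> L * (g x - g ((f ^^ n) x)) + L * (g ((f ^^ n) x) - g ((f ^^ Suc n) x))"
    using Suc assms[of "(f ^^ n) x"] by simp
  finally show ?case by (simp add: algebra_simps)
qed simp

lemma funpow_le_geometric:
  fixes g :: "'a \<Rightarrow> real"
  assumes "0 \<le> r" "\<And>x. g (f x) \<le> r * g x"
  shows "g ((f ^^ n) x) \<le> r ^ n * g x"
proof (induction n)
  case (Suc n)
  then show ?case
    using assms(2)[of "(f ^^ n) x"] mult_left_mono[OF Suc assms(1)] by (simp add: mult.assoc)
qed simp

lemma exists_zero_by_descent:
  fixes f :: "'a::complete_space \<Rightarrow> 'a" and g :: "'a \<Rightarrow> real"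
  assumes continuous: "continuous_on UNIV g" and nonneg: "\<And>x. 0 \<le> g x"
    and r: "0 \<le> r" "r < 1" and contracting: "\<And>x. g (f x) \<le> r * g x"
    and "K \<ge> 0" and step: "\<And>x. dist x (f x) \<le> K * g x"
  shows "\<exists>y. g y = 0 \<and> dist x y \<le> K / (1 - r) * g x"
proof -
  define L where "L = K / (1 - r)"
  have L: "L \<ge> 0" "L * (1 - r) = K" using r \<open>K \<ge> 0\<close> by (auto simp: L_def)
  have descent: "dist x (f x) \<le> L * (g x - g (f x))" for x
  proof -
    have "L * ((1 - r) * g x) \<le> L * (g x - g (f x))"
      using contracting[of x] L by (intro mult_left_mono) (auto simp: algebra_simps)
    then show ?thesis using step[of x] L(2) by (simp add: mult.assoc[symmetric])
  qed
  define u where "u n = (f ^^ n) x" for n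
  have g_u: "(\<lambda>n. g (u n)) \<longlonglongrightarrow> 0"
  proof (rule Lim_null_comparison)
    show "\<forall>\<^sub>F n in sequentially. norm (g (u n)) \<le> r ^ n * g x"
      using funpow_le_geometric[where g = g, OF r(1) contracting] nonneg by (simp add: u_def)
    show "(\<lambda>n. r ^ n * g x) \<longlonglongrightarrow> 0"
      using r by (intro tendsto_mult_left_zero LIMSEQ_realpow_zero)
  qed
  have dist_u: "dist (u n) (u (n + k)) \<le> L * g (u n)" for n k
  proof -
    have "u (n + k) = (f ^^ k) (u n)" unfolding u_def add.commute[of n k] funpow_add by simp
    then show ?thesis
      using dist_funpow_le_descent[OF descent, of "u n" k]
        mult_nonneg_nonneg[OF L(1) nonneg[of "u (n + k)"]]
      by (simp add: right_diff_distrib)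
  qed
  then have "Cauchy u"
    by (rule Cauchy_if_dist_le_null_sequence) (rule tendsto_mult_right_zero[OF g_u])
  then obtain y where lim: "u \<longlonglongrightarrow> y" using Cauchy_convergent convergent_def by blast
  then have "(\<lambda>n. g (u n)) \<longlonglongrightarrow> g y" using continuous by (simp add: continuous_on_tendsto_compose)
  then have "g y = 0" using g_u LIMSEQ_unique by blast
  moreover have "dist x y \<le> L * g x"
    by (rule LIMSEQ_le_const2[OF tendsto_dist[OF tendsto_const lim]])
      (use dist_u[of 0] in \<open>auto simp: u_def\<close>)
  ultimately show ?thesis unfolding L_def by blast
qed

locale symmetric_operator = bounded_linear S for S :: "'a::real_inner \<Rightarrow> 'a" +
  assumes symmetric: "inner (S x) y = inner x (S y)"
begin

text \<open>Positivity of the form at \<open>x - S x / K\<close>.\<close>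

lemma norm_sq_le_form:
  assumes positive: "\<And>x. 0 \<le> inner (S x) x"
    and K_pos: "K > 0" and norm_le: "\<And>x. norm (S x) \<le> K * norm x"
  shows "(norm (S x))\<^sup>2 \<le> K * inner (S x) x"
proof -
  have "0 \<le> inner (S (x - (1 / K) *\<^sub>R S x)) (x - (1 / K) *\<^sub>R S x)" by (rule positive)
  also have "\<dots> = inner (S x) x - 2 / K * (norm (S x))\<^sup>2 + (1 / K)\<^sup>2 * inner (S (S x)) (S x)"
    unfolding power2_norm_eq_inner
    by (simp add: diff scaleR inner_diff_left inner_diff_right symmetric[of "S x" x]
        power2_eq_square algebra_simps)
  also have "\<dots> \<le> inner (S x) x - 2 / K * (norm (S x))\<^sup>2 + (1 / K)\<^sup>2 * (K * (norm (S x))\<^sup>2)"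
  proof (intro add_left_mono mult_left_mono)
    have "inner (S (S x)) (S x) \<le> norm (S (S x)) * norm (S x)" by (rule norm_cauchy_schwarz)
    also have "\<dots> \<le> K * norm (S x) * norm (S x)" by (intro mult_right_mono norm_le) simp
    finally show "inner (S (S x)) (S x) \<le> K * (norm (S x))\<^sup>2" by (simp add: power2_eq_square)
  qed simp
  finally have "0 \<le> inner (S x) x - 1 / K * (norm (S x))\<^sup>2"
    using K_pos by (simp add: power2_eq_square)
  then show ?thesis using K_pos by (simp add: field_simps)
qed

lemma form_ge_if_bounded_below:
  assumes positive: "\<And>x. 0 \<le> inner (S x) x" and "bounded_below S"
  shows "\<exists>c>0. \<forall>x. c * (norm x)\<^sup>2 \<le> inner (S x) x"
proof -
  obtain K where K_pos: "K > 0" and norm_le: "\<And>x. norm (S x) \<le> norm x * K"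
    using pos_bounded by blast
  obtain c where c_pos: "c > 0" and norm_ge: "\<And>x. c * norm x \<le> norm (S x)"
    using assms(2) unfolding bounded_below_def by blast
  have "c\<^sup>2 / K * (norm x)\<^sup>2 \<le> inner (S x) x" for x
  proof -
    have "(c * norm x)\<^sup>2 \<le> (norm (S x))\<^sup>2" using c_pos norm_ge by (intro power_mono) auto
    also have "\<dots> \<le> K * inner (S x) x"
      using norm_sq_le_form[OF positive K_pos] norm_le by (simp add: mult.commute)
    finally show ?thesis using K_pos by (simp add: field_simps power_mult_distrib)
  qed
  then show ?thesis using c_pos K_pos by (intro exI[of _ "c\<^sup>2 / K"]) auto
qed

text \<open>\<open>S\<^sup>2 - m\<^sup>2 = (S - m) (S + m)\<close> is positive and bounded below, hence \<open>S\<^sup>2 \<ge> m\<^sup>2 + c\<close>.\<close>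

lemma lower_bound_improvable:
  assumes m_nonneg: "m \<ge> 0" and norm_ge: "\<And>x. m * norm x \<le> norm (S x)"
    and minus: "bounded_below (\<lambda>x. S x - m *\<^sub>R x)" and plus: "bounded_below (\<lambda>x. S x + m *\<^sub>R x)"
  shows "\<exists>m'>m. \<forall>x. m' * norm x \<le> norm (S x)"
proof -
  define Q where "Q x = S (S x) - m\<^sup>2 *\<^sub>R x" for x
  interpret Q: symmetric_operator Q
  proof (intro symmetric_operator.intro symmetric_operator_axioms.intro)
    show "bounded_linear Q"
      unfolding Q_def by (intro bounded_linear_sub bounded_linear_compose[OF bounded_linear_axioms]
          bounded_linear_axioms bounded_linear_scaleR_right)
    show "inner (Q x) y = inner x (Q y)" for x y
      by (simp add: Q_def inner_diff_left inner_diff_right symmetric)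
  qed
  have form: "inner (Q x) x = (norm (S x))\<^sup>2 - m\<^sup>2 * (norm x)\<^sup>2" for x
    by (simp add: Q_def inner_diff_left symmetric power2_norm_eq_inner)
  have "0 \<le> inner (Q x) x" for x
    using power_mono[OF norm_ge[of x], of 2] m_nonneg by (simp add: form power_mult_distrib)
  moreover have "bounded_below Q"
  proof -
    have "Q = (\<lambda>x. S (S x + m *\<^sub>R x) - m *\<^sub>R (S x + m *\<^sub>R x))"
      by (auto simp: Q_def add scaleR scaleR_add_right power2_eq_square)
    then show ?thesis using bounded_below_compose[OF minus plus] by simp
  qed
  ultimately obtain c where c_pos: "c > 0" and form_ge: "\<And>x. c * (norm x)\<^sup>2 \<le> inner (Q x) x"
    using Q.form_ge_if_bounded_below by blast
  define m' where "m' = sqrt (m\<^sup>2 + c)"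
  have "m' * norm x \<le> norm (S x)" for x
  proof (rule power2_le_imp_le)
    show "(m' * norm x)\<^sup>2 \<le> (norm (S x))\<^sup>2"
      using form_ge[of x] c_pos by (simp add: form m'_def power_mult_distrib distrib_right)
  qed simp
  moreover have "m' > m" unfolding m'_def using m_nonneg c_pos by (intro real_less_rsqrt) simp
  ultimately show ?thesis by blast
qed

lemma norm_ge_if_spectral_gap:
  assumes gap: "\<And>t. \<bar>t\<bar> < s \<Longrightarrow> bounded_below (\<lambda>x. S x - t *\<^sub>R x)"
  shows "s * norm x \<le> norm (S x)"
proof (rule ccontr)
  assume violated: "\<not> s * norm x \<le> norm (S x)"
  then have "x \<noteq> 0" by auto
  define M where "M = (\<lambda>y. norm (S y) / norm y) ` (- {0})"
  define m where "m = Inf M"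
  have M: "M \<noteq> {}" "bdd_below M" using \<open>x \<noteq> 0\<close> by (auto simp: M_def intro!: bdd_belowI[of _ 0])
  have m_nonneg: "m \<ge> 0" unfolding m_def by (rule cInf_greatest[OF M(1)]) (auto simp: M_def)
  have norm_ge: "m * norm y \<le> norm (S y)" for y
  proof (cases "y = 0")
    case False
    then have "m \<le> norm (S y) / norm y" unfolding m_def by (intro cInf_lower M) (auto simp: M_def)
    then show ?thesis using False by (simp add: field_simps)
  qed (simp add: zero)
  have "m * norm x < s * norm x" using violated norm_ge[of x] by simp
  then have "m < s" using \<open>x \<noteq> 0\<close> by simp
  then have "bounded_below (\<lambda>x. S x - m *\<^sub>R x)" "bounded_below (\<lambda>x. S x + m *\<^sub>R x)"
    using gap[of m] gap[of "- m"] m_nonneg by simp_all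
  then obtain m' where "m' > m" and norm_ge': "\<And>x. m' * norm x \<le> norm (S x)"
    using lower_bound_improvable[OF m_nonneg norm_ge] by blast
  have "m' \<le> norm (S y) / norm y" if "y \<noteq> 0" for y
    using norm_ge'[of y] that by (simp add: pos_le_divide_eq)
  then have "m' \<le> m" unfolding m_def by (intro cInf_greatest[OF M(1)]) (auto simp: M_def)
  then show False using \<open>m' > m\<close> by simp
qed

end

section \<open>Finite-dimensional spans and compact operators\<close>

lemma exists_orthogonal_projection:
  fixes B :: "'a::real_inner set"
  assumes "finite B"
  obtains P where "\<And>a. P a \<in> span B" "\<And>a v. v \<in> span B \<Longrightarrow> inner (a - P a) v = 0"
    "\<And>x. (\<And>v. (\<lambda>n::nat. inner (x n) v) \<longlonglongrightarrow> 0) \<Longrightarrow> (\<lambda>n. P (x n)) \<longlonglongrightarrow> 0"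
proof -
  obtain C where C: "finite C" "span C = span B" "pairwise orthogonal C"
    using basis_orthogonal[OF assms] by blast
  define P where "P a = (\<Sum>b\<in>C. (inner a b / inner b b) *\<^sub>R b)" for a
  have "orthogonal (a - P a) c" if "c \<in> C" for a c
  proof -
    have "(\<Sum>b\<in>C. inner a b / inner b b * inner b c) = (\<Sum>b\<in>{c}. inner a b / inner b b * inner b c)"
      by (rule sum.mono_neutral_right)
        (use C(1,3) that in \<open>auto simp: pairwise_def orthogonal_def\<close>)
    then show ?thesis
      by (cases "c = 0") (auto simp: P_def orthogonal_def inner_diff_left inner_sum_left)
  qed
  then have residual: "inner (a - P a) v = 0" if "v \<in> span B" for a v
    using orthogonal_to_span[of v C] that C(2) unfolding orthogonal_def by blast
  have in_span: "P a \<in> span B" for a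
    unfolding P_def C(2)[symmetric] by (intro span_sum span_scale span_base)
  have null: "(\<lambda>n. P (x n)) \<longlonglongrightarrow> 0" if "\<And>v. (\<lambda>n::nat. inner (x n) v) \<longlonglongrightarrow> 0" for x
  proof -
    have "(\<lambda>n. P (x n)) \<longlonglongrightarrow> (\<Sum>b\<in>C. 0 *\<^sub>R b)"
      unfolding P_def by (intro tendsto_sum tendsto_scaleR tendsto_divide_zero that tendsto_const)
    then show ?thesis by simp
  qed
  show thesis by (rule that[OF in_span residual null])
qed

lemma weakly_null_not_close_to_finite_span:
  fixes x :: "nat \<Rightarrow> 'a::real_inner"
  assumes unit: "\<And>n. norm (x n) = 1" and null: "\<And>v. (\<lambda>n. inner (x n) v) \<longlonglongrightarrow> 0"
    and "finite B" and y: "\<And>n. y n \<in> span B"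
  shows "\<not> (\<lambda>n. x n - y n) \<longlonglongrightarrow> 0"
proof
  assume close: "(\<lambda>n. x n - y n) \<longlonglongrightarrow> 0"
  obtain P where P: "\<And>a. P a \<in> span B" "\<And>a v. v \<in> span B \<Longrightarrow> inner (a - P a) v = 0"
    and P_null: "(\<lambda>n. P (x n)) \<longlonglongrightarrow> 0"
    using exists_orthogonal_projection[OF \<open>finite B\<close>] null by metis
  have "norm (x n - P (x n)) \<le> norm (x n - y n)" for n
  proof -
    have "inner (x n - P (x n)) (y n - P (x n)) = 0" using P y by (simp add: span_diff)
    then have "(norm (x n - P (x n)))\<^sup>2 = inner (x n - P (x n)) (x n - y n)"
      by (simp add: power2_norm_eq_inner inner_diff_right)
    also have "\<dots> \<le> norm (x n - P (x n)) * norm (x n - y n)" by (rule norm_cauchy_schwarz)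
    finally show ?thesis by (auto simp: power2_eq_square mult_le_cancel_left)
  qed
  then have "(\<lambda>n. x n - P (x n)) \<longlonglongrightarrow> 0"
    by (intro Lim_null_comparison[OF _ tendsto_norm_zero[OF close]]) auto
  then have "(\<lambda>n. norm (x n - P (x n) + P (x n))) \<longlonglongrightarrow> 0"
    using P_null by (intro tendsto_norm_zero tendsto_add_zero)
  then show False by (simp add: unit LIMSEQ_const_iff)
qed

lemma exists_unit_orthogonal:
  fixes V :: "'a::real_inner set"
  assumes "subspace V" "finite B" "B \<subseteq> V" "\<not> V \<subseteq> span B"
  shows "\<exists>v. v \<in> V \<and> norm v = 1 \<and> (\<forall>b\<in>B. inner v b = 0)"
proof -
  obtain a where a: "a \<in> V" "a \<notin> span B" using assms(4) by blast
  obtain P where P: "\<And>a. P a \<in> span B" "\<And>a v. v \<in> span B \<Longrightarrow> inner (a - P a) v = 0"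
    by (rule exists_orthogonal_projection[OF \<open>finite B\<close>]) blast
  have "a - P a \<in> V"
    using a(1) P(1) span_minimal[OF \<open>B \<subseteq> V\<close> \<open>subspace V\<close>] \<open>subspace V\<close>
    by (auto intro: subspace_diff)
  moreover have "a - P a \<noteq> 0" using a(2) P(1)[of a] by auto
  moreover have "\<forall>b\<in>B. inner (a - P a) b = 0" by (auto intro: P(2) span_base)
  ultimately show ?thesis
    using \<open>subspace V\<close>
    by (intro exI[of _ "(1 / norm (a - P a)) *\<^sub>R (a - P a)"]) (auto intro: subspace_scale)
qed

lemma finite_span_if_unit_sphere_compact:
  fixes V :: "'a::real_inner set"
  assumes "subspace V"
    and compact: "\<And>x::nat \<Rightarrow> 'a. (\<And>n. x n \<in> V) \<Longrightarrow> (\<And>n. norm (x n) = 1)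
      \<Longrightarrow> \<exists>r. strict_mono r \<and> convergent (\<lambda>n. x (r n))"
  shows "\<exists>B. finite B \<and> V \<subseteq> span B"
proof (rule ccontr)
  assume infinite: "\<not> (\<exists>B. finite B \<and> V \<subseteq> span B)"
  have "\<exists>x. \<forall>n::nat. x n \<in> V \<and> norm (x n) = 1 \<and> (\<forall>m<n. inner (x n) (x m) = 0)"
  proof (rule dependent_wellorder_choice)
    fix n :: nat and x :: "nat \<Rightarrow> 'a"
    assume "\<And>m. m < n \<Longrightarrow> x m \<in> V \<and> norm (x m) = 1 \<and> (\<forall>k<m. inner (x m) (x k) = 0)"
    then show "\<exists>v. v \<in> V \<and> norm v = 1 \<and> (\<forall>m<n. inner v (x m) = 0)"
      using exists_unit_orthogonal[OF \<open>subspace V\<close>, of "x ` {..<n}"] infinite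
      by (auto simp: image_subset_iff Ball_def)
  qed auto
  then obtain x :: "nat \<Rightarrow> 'a"
    where "\<forall>n. x n \<in> V \<and> norm (x n) = 1 \<and> (\<forall>m<n. inner (x n) (x m) = 0)" ..
  then have unit: "\<And>n. x n \<in> V" "\<And>n. norm (x n) = 1"
    and orthogonal: "\<And>m n. m < n \<Longrightarrow> inner (x n) (x m) = 0" by blast+
  obtain r :: "nat \<Rightarrow> nat" where r: "strict_mono r" "convergent (\<lambda>n. x (r n))"
    using compact[of x, OF unit] by blast
  then obtain N where "\<And>m n. m \<ge> N \<Longrightarrow> n \<ge> N \<Longrightarrow> norm (x (r m) - x (r n)) < 1"
    using CauchyD[OF convergent_Cauchy[OF r(2)], of 1] by auto
  then have "norm (x (r (Suc N)) - x (r N)) < 1" by simp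
  moreover have "(norm (x (r (Suc N)) - x (r N)))\<^sup>2 = 2"
    using dot_norm_neg[of "x (r (Suc N))" "x (r N)"] orthogonal[of "r N" "r (Suc N)"] r(1) unit(2)
    by (simp add: strict_monoD)
  ultimately show False
    using power_strict_mono[of "norm (x (r (Suc N)) - x (r N))" 1 2] by auto
qed

definition compact_operator :: "('a::real_normed_vector \<Rightarrow> 'b::real_normed_vector) \<Rightarrow> bool" where
  "compact_operator K \<longleftrightarrow> bounded_linear K
    \<and> (\<forall>x. bounded (range x) \<longrightarrow> (\<exists>r::nat \<Rightarrow> nat. strict_mono r \<and> convergent (\<lambda>n. K (x (r n)))))"

definition bounded_below_mod_compact ::
    "('a::real_normed_vector \<Rightarrow> 'b::real_normed_vector) \<Rightarrow> bool" where
  "bounded_below_mod_compact f \<longleftrightarrow>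
    (\<exists>C. \<exists>K::'a \<Rightarrow> 'a. compact_operator K \<and> (\<forall>x. norm x \<le> C * (norm (f x) + norm (K x))))"

lemma Cauchy_if_dist_le_sum:
  fixes u :: "nat \<Rightarrow> 'a::metric_space"
    and v :: "nat \<Rightarrow> 'b::metric_space" and w :: "nat \<Rightarrow> 'c::metric_space"
  assumes dist_le: "\<And>m n. dist (u m) (u n) \<le> C * (dist (v m) (v n) + dist (w m) (w n))"
    and "Cauchy v" "Cauchy w"
  shows "Cauchy u"
proof (rule metric_CauchyI)
  fix e :: real assume "e > 0"
  define L where "L = \<bar>C\<bar> + 1"
  have L: "L > 0" "C \<le> L" by (auto simp: L_def)
  with \<open>e > 0\<close> have "e / (2 * L) > 0" by simp
  then obtain M1 M2 where dist_v: "\<And>m n. m \<ge> M1 \<Longrightarrow> n \<ge> M1 \<Longrightarrow> dist (v m) (v n) < e / (2 * L)"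
    and dist_w: "\<And>m n. m \<ge> M2 \<Longrightarrow> n \<ge> M2 \<Longrightarrow> dist (w m) (w n) < e / (2 * L)"
    using metric_CauchyD[OF \<open>Cauchy v\<close>] metric_CauchyD[OF \<open>Cauchy w\<close>] by metis
  have "dist (u m) (u n) < e" if "m \<ge> max M1 M2" "n \<ge> max M1 M2" for m n
  proof -
    have "dist (u m) (u n) \<le> L * (dist (v m) (v n) + dist (w m) (w n))"
      by (rule order_trans[OF dist_le]) (intro mult_right_mono L, simp)
    also have "\<dots> < L * (e / (2 * L) + e / (2 * L))"
      by (intro mult_strict_left_mono add_strict_mono dist_v dist_w) (use that L in auto)
    also have "\<dots> = e" using L by simp
    finally show ?thesis .
  qed
  then show "\<exists>M. \<forall>m\<ge>M. \<forall>n\<ge>M. dist (u m) (u n) < e" by blast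
qed

lemma convergent_subsequence_mod_compact:
  fixes f :: "'a::banach \<Rightarrow> 'b::real_normed_vector"
  assumes f: "bounded_linear f" "bounded_below_mod_compact f"
    and bounded: "bounded (range x)" and lim: "(\<lambda>n. f (x n)) \<longlonglongrightarrow> 0"
  obtains r :: "nat \<Rightarrow> nat" and l where "strict_mono r" "(\<lambda>n. x (r n)) \<longlonglongrightarrow> l" "f l = 0"
proof -
  interpret f: bounded_linear f by (rule f(1))
  obtain C and K :: "'a \<Rightarrow> 'a" where compact: "compact_operator K"
    and norm_le: "\<And>v. norm v \<le> C * (norm (f v) + norm (K v))"
    using f(2) unfolding bounded_below_mod_compact_def by blast
  interpret K: bounded_linear K using compact by (simp add: compact_operator_def)
  obtain r :: "nat \<Rightarrow> nat" where r: "strict_mono r" and K_convergent: "convergent (\<lambda>n. K (x (r n)))"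
    using compact bounded unfolding compact_operator_def by blast
  have lim_r: "(\<lambda>n. f (x (r n))) \<longlonglongrightarrow> 0"
    using LIMSEQ_subseq_LIMSEQ[OF lim r] by (simp add: o_def)
  have "Cauchy (\<lambda>n. x (r n))"
  proof (rule Cauchy_if_dist_le_sum)
    show "dist (x (r m)) (x (r n))
        \<le> C * (dist (f (x (r m))) (f (x (r n))) + dist (K (x (r m))) (K (x (r n))))" for m n
      using norm_le[of "x (r m) - x (r n)"] by (simp add: dist_norm f.diff K.diff)
  qed (use lim_r K_convergent LIMSEQ_imp_Cauchy convergent_Cauchy in blast)+
  then obtain l where l: "(\<lambda>n. x (r n)) \<longlonglongrightarrow> l" using Cauchy_convergent convergent_def by blast
  have "f l = 0" by (rule LIMSEQ_unique[OF f.tendsto[OF l] lim_r])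
  then show thesis using that r l by blast
qed

lemma finite_span_kernel_mod_compact:
  fixes f :: "'a::{real_inner,banach} \<Rightarrow> 'b::real_normed_vector"
  assumes f: "bounded_linear f" "bounded_below_mod_compact f"
  shows "\<exists>B. finite B \<and> {x. f x = 0} \<subseteq> span B"
proof (rule finite_span_if_unit_sphere_compact)
  show "subspace {x. f x = 0}"
    by (rule linear_subspace_kernel) (rule bounded_linear.linear[OF f(1)])
  fix x :: "nat \<Rightarrow> 'a" assume "\<And>n. x n \<in> {x. f x = 0}" and unit: "\<And>n. norm (x n) = 1"
  then have "(\<lambda>n. f (x n)) \<longlonglongrightarrow> 0" by simp
  moreover have "bounded (range x)" using unit by (intro boundedI[of _ 1]) auto
  ultimately show "\<exists>r. strict_mono r \<and> convergent (\<lambda>n. x (r n))"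
    using convergent_subsequence_mod_compact[OF f] unfolding convergent_def by metis
qed

section \<open>Unitary operators\<close>

locale complex_scaling =
  fixes scaleC :: "complex \<Rightarrow> 'a::real_inner \<Rightarrow> 'a"
  assumes scaleC_of_real: "scaleC (of_real r) x = r *\<^sub>R x"
    and scaleC_scaleC: "scaleC z (scaleC w x) = scaleC (z * w) x"
    and scaleC_add_left: "scaleC (z + w) x = scaleC z x + scaleC w x"
    and scaleC_add_right: "scaleC z (x + y) = scaleC z x + scaleC z y"
    and inner_scaleC_left: "inner (scaleC z x) y = inner x (scaleC (cnj z) y)"
begin

lemma norm_scaleC [simp]: "norm (scaleC z x) = cmod z * norm x"
proof (rule power2_eq_imp_eq)
  have "(norm (scaleC z x))\<^sup>2 = inner x (scaleC (of_real ((cmod z)\<^sup>2)) x)"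
    unfolding complex_norm_square
    by (simp add: power2_norm_eq_inner inner_scaleC_left scaleC_scaleC mult.commute)
  also have "\<dots> = (cmod z)\<^sup>2 * (norm x)\<^sup>2"
    unfolding scaleC_of_real by (simp add: power2_norm_eq_inner)
  finally show "(norm (scaleC z x))\<^sup>2 = (cmod z * norm x)\<^sup>2"
    by (simp add: power_mult_distrib)
qed simp_all

sublocale scaleC: bounded_bilinear scaleC
proof
  fix r z x
  show "scaleC (r *\<^sub>R z) x = r *\<^sub>R scaleC z x"
    by (simp add: scaleR_conv_of_real scaleC_of_real flip: scaleC_scaleC)
  show "scaleC z (r *\<^sub>R x) = r *\<^sub>R scaleC z x"
    by (simp add: scaleC_scaleC mult.commute flip: scaleC_of_real)
qed (auto simp: scaleC_add_left scaleC_add_right intro: exI[of _ 1])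

lemma scaleC_1 [simp]: "scaleC 1 x = x"
  using scaleC_of_real[of 1 x] by simp

end

locale unitary_operator = complex_scaling scaleC
  for scaleC :: "complex \<Rightarrow> 'a::{real_inner,banach} \<Rightarrow> 'a" +
  fixes U V :: "'a \<Rightarrow> 'a"
  assumes U_add: "U (x + y) = U x + U y"
    and U_scaleC: "U (scaleC z x) = scaleC z (U x)"
    and norm_U [simp]: "norm (U x) = norm x"
    and U_V [simp]: "U (V x) = x" and V_U [simp]: "V (U x) = x"
begin

lemma V_scaleC: "V (scaleC z x) = scaleC z (V x)"
  by (metis U_scaleC U_V V_U)

lemma norm_V [simp]: "norm (V x) = norm x"
  by (metis norm_U U_V)

sublocale U: bounded_linear U
proof (rule bounded_linear_intro[of _ 1])
  show "U (r *\<^sub>R x) = r *\<^sub>R U x" for r x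
    by (simp add: U_scaleC flip: scaleC_of_real)
qed (simp_all add: U_add)

sublocale V: bounded_linear V
proof (rule bounded_linear_intro[of _ 1])
  show "V (x + y) = V x + V y" for x y by (metis U_add U_V V_U)
  show "V (r *\<^sub>R x) = r *\<^sub>R V x" for r x
    by (simp add: V_scaleC flip: scaleC_of_real)
qed simp

lemma inner_U_left: "inner (U x) y = inner x (V y)"
proof -
  have "inner (U x) (U (V y)) = inner x (V y)"
    unfolding dot_norm U.add[symmetric] by (simp del: U_V)
  then show ?thesis by simp
qed

definition T :: "complex \<Rightarrow> 'a \<Rightarrow> 'a" where
  "T z x = U x - scaleC z x"

definition T_adj :: "complex \<Rightarrow> 'a \<Rightarrow> 'a" where
  "T_adj z x = V x - scaleC (cnj z) x"

sublocale T: bounded_linear "T z" for z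
  unfolding T_def by (intro bounded_linear_sub U.bounded_linear_axioms scaleC.bounded_linear_right)

sublocale T_adj: bounded_linear "T_adj z" for z
  unfolding T_adj_def
  by (intro bounded_linear_sub V.bounded_linear_axioms scaleC.bounded_linear_right)

lemma inner_T_left: "inner (T z x) y = inner x (T_adj z y)"
  by (simp add: T_def T_adj_def inner_diff_left inner_diff_right inner_U_left inner_scaleC_left)

lemma T_scaleC: "T z (scaleC w x) = scaleC w (T z x)"
  by (simp add: T_def U_scaleC scaleC.diff_right scaleC_scaleC mult.commute)

lemma norm_T_adj: "norm (T_adj z x) = norm (T z x)"
proof -
  have "T_adj z (T z x) = T z (T_adj z x)"
    by (simp add: T_def T_adj_def U.diff V.diff V_scaleC U_scaleC scaleC.diff_right
        scaleC_scaleC algebra_simps)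
  then have "(norm (T z x))\<^sup>2 = inner x (T z (T_adj z x))"
    by (simp add: power2_norm_eq_inner inner_T_left)
  also have "\<dots> = (norm (T_adj z x))\<^sup>2"
    by (simp add: power2_norm_eq_inner inner_T_left inner_commute[of x])
  finally show ?thesis by simp
qed

lemma norm_T_le: "norm (T z x) \<le> (1 + cmod z) * norm x"
  unfolding T_def by (rule order_trans[OF norm_triangle_ineq4]) (simp add: algebra_simps)

lemma T_eq_T_plus_scaleC: "T z x = T w x + scaleC (w - z) x"
  by (simp add: T_def scaleC.diff_left)

lemma norm_T_perturbation: "norm (T z x) - cmod (w - z) * norm x \<le> norm (T w x)"
  using norm_triangle_ineq[of "T w x" "scaleC (w - z) x"]
  by (simp add: T_eq_T_plus_scaleC[of z x w])

lemma bij_T_off_circle: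
  assumes "cmod z \<noteq> 1"
  shows "bij (T z)"
proof (cases "cmod z < 1")
  case True
  have "bij U" by (rule o_bij[of V]) auto
  then have "bij (\<lambda>x. U x + scaleC (- z) x)"
    by (rule bij_add_lipschitz[where c = 1 and d = "cmod z"])
      (use True in \<open>auto simp flip: U.diff scaleC.diff_right\<close>)
  then show ?thesis by (simp add: T_def[abs_def] scaleC.minus_left)
next
  case False
  then have z: "cmod z > 1" "z \<noteq> 0" using assms by auto
  have "bij (scaleC (- z))"
    by (rule o_bij[of "scaleC (- inverse z)"]) (use z in \<open>auto simp: scaleC_scaleC\<close>)
  then have "bij (\<lambda>x. scaleC (- z) x + U x)"
    by (rule bij_add_lipschitz[where c = "cmod z" and d = 1])
      (use z in \<open>auto simp flip: U.diff scaleC.diff_right\<close>)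
  then show ?thesis by (simp add: T_def[abs_def] scaleC.minus_left)
qed

text \<open>A point of the unit circle is a limit of points off the circle, at which \<open>T\<close> is bijective and
  satisfies nearly the same lower bound.\<close>

lemma bounded_below_imp_bij_T:
  assumes "bounded_below (T z)"
  shows "bij (T z)"
proof (cases "cmod z = 1")
  case True
  obtain c where c_pos: "c > 0" and T_ge: "\<And>x. c * norm x \<le> norm (T z x)"
    using assms unfolding bounded_below_def by blast
  define w where "w = of_real (1 + c / 4) * z"
  have "w - z = of_real (c / 4) * z" by (simp add: w_def algebra_simps)
  then have dist_w: "cmod (w - z) = c / 4" using c_pos True by (simp only: norm_mult norm_of_real)
  have "cmod w \<noteq> 1" using c_pos True unfolding w_def norm_mult norm_of_real by simp
  then have "bij (T w)" by (rule bij_T_off_circle)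
  then have "bij (\<lambda>x. T w x + scaleC (w - z) x)"
  proof (rule bij_add_lipschitz[where c = "3 / 4 * c" and d = "c / 4"])
    show "3 / 4 * c * norm (x - y) \<le> norm (T w x - T w y)" for x y
      using T_ge[of "x - y"] norm_T_perturbation[of z "x - y" w] by (simp add: dist_w T.diff)
  qed (use c_pos in \<open>auto simp: dist_w simp flip: scaleC.diff_right\<close>)
  then show ?thesis by (simp flip: T_eq_T_plus_scaleC)
qed (rule bij_T_off_circle)

lemma bij_T_iff_bounded_below: "bij (T z) \<longleftrightarrow> bounded_below (T z)"
proof
  assume "bij (T z)"
  then have "bounded_below (T_adj z)"
    using surj_imp_adjoint_bounded_below[OF inner_T_left T_adj.linear_axioms] bij_is_surj by blast
  then show "bounded_below (T z)" by (simp add: bounded_below_def norm_T_adj)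
qed (rule bounded_below_imp_bij_T)

lemma not_bounded_below_imp_norm_1: "\<not> bounded_below (T z) \<Longrightarrow> cmod z = 1"
  using bij_T_off_circle bij_T_iff_bounded_below by blast

lemma T_T_eq:
  assumes "cmod z = 1" "cmod w = 1"
  shows "T (z * w) (T (z * cnj w) x)
    = scaleC z (U (scaleC (cnj z) (U x) + scaleC z (V x) - (2 * Re w) *\<^sub>R x))"
proof -
  have z_unit: "z * cnj z = 1" and w_unit: "w * cnj w = 1"
    using assms by (simp_all add: complex_norm_square[symmetric])
  have "T (z * w) (T (z * cnj w) x)
      = U (U x) - (scaleC (z * cnj w) (U x) + scaleC (z * w) (U x))
        + scaleC (z * z * (w * cnj w)) x"
    by (simp add: T_def U.diff U_scaleC scaleC.diff_right scaleC_scaleC algebra_simps)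
  also have "scaleC (z * cnj w) (U x) + scaleC (z * w) (U x) = scaleC (z * of_real (2 * Re w)) (U x)"
    by (simp add: scaleC_add_left[symmetric] distrib_left[symmetric] complex_add_cnj add.commute)
  also have "U (U x) - scaleC (z * of_real (2 * Re w)) (U x) + scaleC (z * z * (w * cnj w)) x
      = scaleC z (U (scaleC (cnj z) (U x) + scaleC z (V x) - scaleC (of_real (2 * Re w)) x))"
    by (simp add: U_add U.diff U_scaleC scaleC_add_right scaleC.diff_right scaleC_scaleC
        z_unit w_unit del: of_real_mult)
  finally show ?thesis unfolding scaleC_of_real .
qed

definition gram :: "complex \<Rightarrow> 'a \<Rightarrow> 'a" where
  "gram z x = T_adj z (T z x)"

lemma inner_gram_left: "inner (gram z x) y = inner (T z x) (T z y)"
  by (simp add: gram_def inner_T_left inner_commute[of _ y] inner_commute[of _ "T z y"])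

sublocale gram: symmetric_operator "gram z" for z
proof (intro symmetric_operator.intro symmetric_operator_axioms.intro)
  show "bounded_linear (gram z)"
    unfolding gram_def
    by (rule bounded_linear_compose[OF T_adj.bounded_linear_axioms T.bounded_linear_axioms])
  show "inner (gram z x) y = inner x (gram z y)" for x y
    by (metis inner_gram_left inner_commute)
qed

lemma norm_gram_le: "cmod z = 1 \<Longrightarrow> norm (gram z x) \<le> 2 * norm (T z x)"
  using norm_T_le[of z "T z x"] by (simp add: gram_def norm_T_adj)

lemma norm_gram_minus:
  assumes "cmod z = 1" "cmod w = 1"
  shows "norm (gram z x - (2 - 2 * Re w) *\<^sub>R x) = norm (T (z * w) (T (z * cnj w) x))"
proof -
  have "cnj z * z = 1" using assms(1) by (simp add: complex_norm_square[symmetric] mult.commute)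
  then have "gram z x - (2 - 2 * Re w) *\<^sub>R x
      = - (scaleC (cnj z) (U x) + scaleC z (V x) - (2 * Re w) *\<^sub>R x)"
    by (simp add: gram_def T_def T_adj_def V.diff V_scaleC scaleC.diff_right scaleC_scaleC
        scaleR_2 algebra_simps)
  then show ?thesis using assms(1) by (simp add: T_T_eq[OF assms] norm_minus_commute)
qed

end

section \<open>Isolated points of the spectrum\<close>

lemma exists_unit_with_Re:
  fixes k :: complex
  assumes "\<bar>t\<bar> \<le> cmod k"
  obtains w where "cmod w = 1" "Re (k * w) = t"
proof (cases "k = 0")
  case True
  then show thesis using that[of 1] assms by simp
next
  case False
  define u where "u = Complex (t / cmod k) (sqrt (1 - (t / cmod k)\<^sup>2))"
  have "\<bar>t / cmod k\<bar> \<le> 1" using assms False by simp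
  then have "(t / cmod k)\<^sup>2 \<le> 1" by (simp add: abs_square_le_1 del: abs_divide)
  then have u: "cmod u = 1" by (simp add: u_def complex_norm)
  show thesis
  proof (rule that[of "cnj (sgn k) * u"])
    show "cmod (cnj (sgn k) * u) = 1" using u False by (simp add: norm_mult norm_sgn)
    have "k * cnj (sgn k) = of_real (cmod k)"
      using complex_norm_square[of k] False by (simp add: sgn_eq power2_eq_square field_simps)
    then have "k * (cnj (sgn k) * u) = of_real (cmod k) * u" by (simp only: mult.assoc[symmetric])
    moreover have "Re (of_real (cmod k) * u) = t" using False by (simp add: u_def)
    ultimately show "Re (k * (cnj (sgn k) * u)) = t" by (simp only:)
  qed
qed

lemma norm_diff_scaleR_sq:
  fixes u v :: "'a::real_inner"
  shows "(norm (u - r *\<^sub>R v))\<^sup>2 = (norm u)\<^sup>2 - 2 * r * inner u v + r\<^sup>2 * (norm v)\<^sup>2"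
  unfolding power2_norm_eq_inner inner_diff_left inner_diff_right
  by (simp add: inner_commute[of v u] power2_eq_square algebra_simps)

context unitary_operator
begin

definition isolated_in_spectrum :: "complex \<Rightarrow> bool" where
  "isolated_in_spectrum z \<longleftrightarrow> (\<exists>e>0. \<forall>w. w \<noteq> z \<longrightarrow> cmod (w - z) < e \<longrightarrow> bounded_below (T w))"

text \<open>The span is over the reals, which does not affect whether it is finite-dimensional.\<close>

definition finite_multiplicity :: "complex \<Rightarrow> bool" where
  "finite_multiplicity z \<longleftrightarrow> (\<exists>B. finite B \<and> {x. T z x = 0} \<subseteq> span B)"

definition weyl_sequence :: "complex \<Rightarrow> (nat \<Rightarrow> 'a) \<Rightarrow> bool" where
  "weyl_sequence z x \<longleftrightarrow> (\<forall>n. norm (x n) = 1) \<and> (\<forall>v. (\<lambda>n. inner (x n) v) \<longlonglongrightarrow> 0)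
    \<and> (\<lambda>n. T z (x n)) \<longlonglongrightarrow> 0"

lemma bounded_below_gram_minus:
  assumes z: "cmod z = 1" and t: "0 < t" "t < 4" "t < e\<^sup>2" and "e > 0"
    and gap: "\<And>w. w \<noteq> z \<Longrightarrow> cmod (w - z) < e \<Longrightarrow> bounded_below (T w)"
  shows "bounded_below (\<lambda>x. gram z x - t *\<^sub>R x)"
proof -
  obtain w where w: "cmod w = 1" "Re w = 1 - t / 2"
    by (rule exists_unit_with_Re[of "1 - t / 2" 1]) (use t in auto)
  have bounded_below_T: "bounded_below (T (z * v))" if v: "cmod v = 1" "Re v = 1 - t / 2" for v
  proof (rule gap)
    have dist_v: "(cmod (v - 1))\<^sup>2 = t"
      using v cmod_power2[of v] cmod_power2[of "v - 1"]
      by (simp add: power2_eq_square algebra_simps)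
    moreover have dist_zv: "cmod (z * v - z) = cmod (v - 1)"
      using norm_mult[of z "v - 1"] z by (simp add: algebra_simps)
    ultimately show "z * v \<noteq> z" using t(1) by auto
    show "cmod (z * v - z) < e"
      unfolding dist_zv by (rule power2_less_imp_less) (use dist_v t \<open>e > 0\<close> in auto)
  qed
  have "bounded_below (\<lambda>x. T (z * w) (T (z * cnj w) x))"
    by (rule bounded_below_compose; rule bounded_below_T) (use w in auto)
  then show ?thesis
    using w by (simp add: bounded_below_def flip: norm_gram_minus[OF z])
qed

lemma isolated_imp_gram_gap:
  assumes z: "cmod z = 1" and "isolated_in_spectrum z"
  obtains s where "0 < s" "s \<le> 2" "\<And>x. 2 * s * (norm (T z x))\<^sup>2 \<le> (norm (gram z x))\<^sup>2"
proof -
  obtain e where e_pos: "e > 0" and gap: "\<And>w. w \<noteq> z \<Longrightarrow> cmod (w - z) < e \<Longrightarrow> bounded_below (T w)"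
    using assms(2) unfolding isolated_in_spectrum_def by blast
  define s where "s = min (e\<^sup>2) 4 / 2"
  have s: "s > 0" "2 * s \<le> e\<^sup>2" "2 * s \<le> 4" using e_pos by (auto simp: s_def)
  interpret S: symmetric_operator "\<lambda>x. gram z x - s *\<^sub>R x"
  proof (intro symmetric_operator.intro symmetric_operator_axioms.intro)
    show "bounded_linear (\<lambda>x. gram z x - s *\<^sub>R x)"
      by (intro bounded_linear_sub gram.bounded_linear_axioms bounded_linear_scaleR_right)
  qed (simp add: inner_diff_left inner_diff_right gram.symmetric)
  have "s * norm x \<le> norm (gram z x - s *\<^sub>R x)" for x
  proof (rule S.norm_ge_if_spectral_gap)
    fix t assume "\<bar>t\<bar> < s"
    then have "bounded_below (\<lambda>x. gram z x - (s + t) *\<^sub>R x)"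
      using s e_pos by (intro bounded_below_gram_minus[OF z _ _ _ e_pos gap]) auto
    then show "bounded_below (\<lambda>x. gram z x - s *\<^sub>R x - t *\<^sub>R x)"
      by (simp add: scaleR_add_left diff_diff_eq)
  qed
  then have "(s * norm x)\<^sup>2 \<le> (norm (gram z x - s *\<^sub>R x))\<^sup>2" for x
    using s(1) by (intro power_mono) auto
  then have "2 * s * (norm (T z x))\<^sup>2 \<le> (norm (gram z x))\<^sup>2" for x
    by (simp add: norm_diff_scaleR_sq inner_gram_left power2_norm_eq_inner[of "T z x"]
        power_mult_distrib)
  then show thesis using that[of s] s by simp
qed

lemma norm_T_gram_step_le:
  assumes z: "cmod z = 1" and "s \<le> 2"
    and gap: "\<And>x. 2 * s * (norm (T z x))\<^sup>2 \<le> (norm (gram z x))\<^sup>2"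
  shows "norm (T z (x - (1/4) *\<^sub>R gram z x)) \<le> sqrt (1 - s / 2) * norm (T z x)"
proof (rule power2_le_imp_le)
  have "(norm (T z (x - (1/4) *\<^sub>R gram z x)))\<^sup>2
      = (norm (T z x))\<^sup>2 - 1/2 * (norm (gram z x))\<^sup>2 + 1/16 * (norm (T z (gram z x)))\<^sup>2"
    unfolding T.diff T.scaleR norm_diff_scaleR_sq inner_gram_left[symmetric]
    by (simp add: gram.symmetric power2_norm_eq_inner power_divide)
  also have "(norm (T z (gram z x)))\<^sup>2 \<le> (2 * norm (gram z x))\<^sup>2"
    using norm_T_le[of z "gram z x"] z by (intro power_mono) auto
  finally have "(norm (T z (x - (1/4) *\<^sub>R gram z x)))\<^sup>2
      \<le> (norm (T z x))\<^sup>2 - 1/4 * (norm (gram z x))\<^sup>2"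
    by (simp add: power_mult_distrib)
  also have "\<dots> \<le> (sqrt (1 - s / 2) * norm (T z x))\<^sup>2"
    using \<open>s \<le> 2\<close> gap[of x] by (simp add: power_mult_distrib algebra_simps)
  finally show "(norm (T z (x - (1/4) *\<^sub>R gram z x)))\<^sup>2 \<le> (sqrt (1 - s / 2) * norm (T z x))\<^sup>2" .
qed (use \<open>s \<le> 2\<close> in simp)

text \<open>Gradient descent for \<open>\<parallel>T z x\<parallel>\<^sup>2\<close>.\<close>

lemma isolated_imp_close_to_kernel:
  assumes z: "cmod z = 1" and "isolated_in_spectrum z"
  shows "\<exists>C. \<forall>x. \<exists>y. T z y = 0 \<and> norm (x - y) \<le> C * norm (T z x)"
proof -
  obtain s where s: "0 < s" "s \<le> 2" and gap: "\<And>x. 2 * s * (norm (T z x))\<^sup>2 \<le> (norm (gram z x))\<^sup>2"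
    by (rule isolated_imp_gram_gap[OF assms]) auto
  define r where "r = sqrt (1 - s / 2)"
  have "\<exists>y. norm (T z y) = 0 \<and> dist x y \<le> (1/2) / (1 - r) * norm (T z x)" for x
  proof (rule exists_zero_by_descent)
    show "norm (T z (x - (1/4) *\<^sub>R gram z x)) \<le> r * norm (T z x)" for x
      unfolding r_def by (rule norm_T_gram_step_le[OF z s(2) gap])
    show "dist x (x - (1/4) *\<^sub>R gram z x) \<le> 1/2 * norm (T z x)" for x
      using norm_gram_le[OF z, of x] by (simp add: dist_norm)
    show "continuous_on UNIV (\<lambda>x. norm (T z x))"
      by (intro continuous_on_norm T.continuous_on continuous_on_id)
    show "0 \<le> r" "r < 1" using s by (auto simp: r_def)
  qed simp_all
  then show ?thesis unfolding dist_norm norm_eq_zero by blast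
qed

lemma isolated_imp_eigenvector:
  assumes "\<not> bounded_below (T z)" "isolated_in_spectrum z"
  shows "\<exists>x. x \<noteq> 0 \<and> T z x = 0"
proof -
  obtain C where close: "\<And>x. \<exists>y. T z y = 0 \<and> norm (x - y) \<le> C * norm (T z x)"
    using isolated_imp_close_to_kernel[OF not_bounded_below_imp_norm_1] assms by blast
  obtain x where unit: "norm x = 1" and small: "norm (T z x) < 1 / (\<bar>C\<bar> + 1)"
    by (rule not_bounded_belowE[OF T.linear_axioms assms(1), of "1 / (\<bar>C\<bar> + 1)"]) auto
  obtain y where y: "T z y = 0" "norm (x - y) \<le> C * norm (T z x)" using close by blast
  have "C * norm (T z x) \<le> (\<bar>C\<bar> + 1) * norm (T z x)" by (intro mult_right_mono) auto
  also have "\<dots> < 1" using small by (simp add: pos_less_divide_eq mult.commute)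
  finally have "y \<noteq> 0" using unit y(2) by auto
  then show ?thesis using y(1) by blast
qed

lemma weyl_sequence_imp_not_bounded_below:
  assumes "weyl_sequence z x"
  shows "\<not> bounded_below (T z)"
proof
  assume "bounded_below (T z)"
  then obtain c where "c > 0" and T_ge: "\<And>x. c * norm x \<le> norm (T z x)"
    unfolding bounded_below_def by blast
  have "(\<lambda>n. norm (T z (x n))) \<longlonglongrightarrow> 0"
    using assms by (intro tendsto_norm_zero) (simp add: weyl_sequence_def)
  moreover have "c \<le> norm (T z (x n))" for n
    using T_ge[of "x n"] assms by (simp add: weyl_sequence_def)
  ultimately have "c \<le> 0" by (intro LIMSEQ_le_const) auto
  then show False using \<open>c > 0\<close> by simp
qed

lemma weyl_sequence_imp_not_discrete:
  assumes weyl: "weyl_sequence z x" and isolated: "isolated_in_spectrum z"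
  shows "\<not> finite_multiplicity z"
proof
  assume "finite_multiplicity z"
  then obtain B where B: "finite B" "{x. T z x = 0} \<subseteq> span B"
    unfolding finite_multiplicity_def by blast
  have "cmod z = 1"
    using weyl_sequence_imp_not_bounded_below[OF weyl] by (rule not_bounded_below_imp_norm_1)
  then obtain C where close: "\<And>x. \<exists>y. T z y = 0 \<and> norm (x - y) \<le> C * norm (T z x)"
    using isolated_imp_close_to_kernel isolated by blast
  have "\<exists>y. \<forall>n. T z (y n) = 0 \<and> norm (x n - y n) \<le> C * norm (T z (x n))"
    by (rule choice) (use close in blast)
  then obtain y where y: "\<And>n. T z (y n) = 0" "\<And>n. norm (x n - y n) \<le> C * norm (T z (x n))" by blast
  have "(\<lambda>n. C * norm (T z (x n))) \<longlonglongrightarrow> 0"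
    using weyl by (intro tendsto_mult_right_zero tendsto_norm_zero) (simp add: weyl_sequence_def)
  then have "(\<lambda>n. x n - y n) \<longlonglongrightarrow> 0" by (rule Lim_null_comparison[rotated]) (simp add: y(2))
  moreover have "\<not> (\<lambda>n. x n - y n) \<longlonglongrightarrow> 0"
    by (rule weakly_null_not_close_to_finite_span[of x B])
      (use weyl B y(1) in \<open>auto simp: weyl_sequence_def\<close>)
  ultimately show False by blast
qed

lemma inner_T_eigenvector:
  assumes "T z y = 0"
  shows "inner (T w x) y = inner (scaleC (z - w) x) y"
proof -
  have "T_adj z y = 0" using norm_T_adj[of z y] assms by simp
  then show ?thesis by (simp add: T_eq_T_plus_scaleC[of w x z] inner_add_left inner_T_left)
qed

lemma abs_inner_eigenvector_le:
  assumes "T z y = 0" "w \<noteq> z"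
  shows "\<bar>inner x y\<bar> \<le> norm (T w x) / cmod (w - z) * norm y"
proof -
  have "inner x y = inner (T w (scaleC (inverse (z - w)) x)) y"
    using assms(2) by (simp add: inner_T_eigenvector[OF assms(1)] scaleC_scaleC)
  then have "\<bar>inner x y\<bar> \<le> norm (T w (scaleC (inverse (z - w)) x)) * norm y"
    by (simp only: Cauchy_Schwarz_ineq2)
  then show ?thesis
    by (simp add: T_scaleC norm_inverse norm_divide norm_minus_commute[of z] field_simps)
qed

lemma not_isolated_approximate_eigenvectors:
  assumes "\<not> isolated_in_spectrum z"
  shows "\<exists>w x. \<forall>n. w n \<noteq> z \<and> cmod (w n - z) < inverse (real (Suc n))
    \<and> norm (x n) = 1 \<and> norm (T (w n) (x n)) \<le> cmod (w n - z) * inverse (real (Suc n))"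
proof -
  have "\<exists>w x. w \<noteq> z \<and> cmod (w - z) < inverse (real (Suc n))
    \<and> norm x = 1 \<and> norm (T w x) \<le> cmod (w - z) * inverse (real (Suc n))" for n
  proof -
    have "inverse (real (Suc n)) > 0" by simp
    then obtain w where w: "w \<noteq> z" "cmod (w - z) < inverse (real (Suc n))" "\<not> bounded_below (T w)"
      using assms unfolding isolated_in_spectrum_def by blast
    obtain x where "norm x = 1" "norm (T w x) < cmod (w - z) * inverse (real (Suc n))"
      by (rule not_bounded_belowE[OF T.linear_axioms w(3),
            of "cmod (w - z) * inverse (real (Suc n))"]) (use w(1) in auto)
    then show ?thesis using w by (intro exI[of _ w] exI[of _ x]) auto
  qed
  then show ?thesis by metis
qed

lemma approximate_eigenvectors_T_null:
  assumes w_close: "\<And>n. cmod (w n - z) < inverse (real (Suc n))" and unit: "\<And>n. norm (x n) = 1"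
    and approx: "\<And>n. norm (T (w n) (x n)) \<le> cmod (w n - z) * inverse (real (Suc n))"
  shows "(\<lambda>n. T z (x n)) \<longlonglongrightarrow> 0"
proof (rule Lim_null_comparison)
  have "norm (T z (x n)) \<le> 2 * inverse (real (Suc n))" for n
  proof -
    have "norm (T z (x n)) \<le> norm (T (w n) (x n)) + cmod (w n - z)"
      using norm_T_perturbation[of z "x n" "w n"] unit by simp
    also have "norm (T (w n) (x n)) \<le> cmod (w n - z) * 1"
      by (intro order_trans[OF approx] mult_left_mono) (auto simp: inverse_eq_divide)
    finally show ?thesis using w_close[of n] by simp
  qed
  then show "\<forall>\<^sub>F n in sequentially. norm (T z (x n)) \<le> 2 * inverse (real (Suc n))"
    by (rule eventuallyI)
  show "(\<lambda>n. 2 * inverse (real (Suc n))) \<longlonglongrightarrow> 0"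
    by (rule tendsto_mult_right_zero[OF LIMSEQ_inverse_real_of_nat])
qed

text \<open>If the spectrum accumulates at \<open>z\<close>, then sufficiently accurate approximate eigenvectors for
  nearby spectral values are almost orthogonal to the kernel of \<open>T z\<close>, but compactness makes them
  converge into it.\<close>

lemma isolated_if_bounded_below_mod_compact:
  assumes "bounded_below_mod_compact (T z)"
  shows "isolated_in_spectrum z"
proof (rule ccontr)
  assume "\<not> isolated_in_spectrum z"
  then obtain w x where w_neq: "\<And>n. w n \<noteq> z"
    and w_close: "\<And>n. cmod (w n - z) < inverse (real (Suc n))"
    and unit: "\<And>n. norm (x n) = 1"
    and approx: "\<And>n. norm (T (w n) (x n)) \<le> cmod (w n - z) * inverse (real (Suc n))"
    using not_isolated_approximate_eigenvectors by blast
  have "(\<lambda>n. T z (x n)) \<longlonglongrightarrow> 0"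
    by (rule approximate_eigenvectors_T_null[OF w_close unit approx])
  moreover have "bounded (range x)" using unit by (intro boundedI[of _ 1]) auto
  ultimately obtain r :: "nat \<Rightarrow> nat" and y
    where r: "strict_mono r" and lim: "(\<lambda>n. x (r n)) \<longlonglongrightarrow> y" and y: "T z y = 0"
    using convergent_subsequence_mod_compact[OF T.bounded_linear_axioms assms] by blast
  have inner_le: "\<bar>inner (x n) y\<bar> \<le> inverse (real (Suc n)) * norm y" for n
  proof -
    have "\<bar>inner (x n) y\<bar> \<le> norm (T (w n) (x n)) / cmod (w n - z) * norm y"
      by (rule abs_inner_eigenvector_le[OF y w_neq])
    also have "\<dots> \<le> inverse (real (Suc n)) * norm y"
      using approx[of n] w_neq[of n]
      by (intro mult_right_mono) (auto simp: pos_divide_le_eq mult.commute)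
    finally show ?thesis .
  qed
  have "(\<lambda>n. inner (x n) y) \<longlonglongrightarrow> 0"
  proof (rule Lim_null_comparison)
    show "\<forall>\<^sub>F n in sequentially. norm (inner (x n) y) \<le> inverse (real (Suc n)) * norm y"
      unfolding real_norm_def by (rule eventuallyI) (rule inner_le)
    show "(\<lambda>n. inverse (real (Suc n)) * norm y) \<longlonglongrightarrow> 0"
      by (rule tendsto_mult_left_zero[OF LIMSEQ_inverse_real_of_nat])
  qed
  from LIMSEQ_subseq_LIMSEQ[OF this r] have "(\<lambda>n. inner (x (r n)) y) \<longlonglongrightarrow> 0" by (simp add: o_def)
  moreover have "(\<lambda>n. inner (x (r n)) y) \<longlonglongrightarrow> inner y y" by (intro tendsto_inner lim tendsto_const)
  ultimately have "inner y y = 0" by (rule LIMSEQ_unique[symmetric])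
  moreover have "norm y = 1"
    using tendsto_norm[OF lim] unit by (simp add: LIMSEQ_const_iff)
  ultimately show False by simp
qed

end

section \<open>Square-summable families\<close>

definition square_summable :: "('i \<Rightarrow> 'b::real_normed_vector) \<Rightarrow> bool" where
  "square_summable f \<longleftrightarrow> (\<lambda>x. (norm (f x))\<^sup>2) summable_on UNIV"

lemma square_summable_dominated:
  assumes "square_summable f" "\<And>x. norm (g x) \<le> c * norm (f x)"
  shows "square_summable g"
proof -
  have "(\<lambda>x. c\<^sup>2 * (norm (f x))\<^sup>2) summable_on UNIV"
    using assms(1) by (intro summable_on_cmult_right) (simp add: square_summable_def)
  then show ?thesis
    unfolding square_summable_def
    by (rule summable_on_comparison_test)
      (use assms(2) in \<open>auto intro: power_mono simp flip: power_mult_distrib\<close>)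
qed

lemma square_summable_scaleR: "square_summable f \<Longrightarrow> square_summable (\<lambda>x. r *\<^sub>R f x)"
  by (rule square_summable_dominated[of f _ "\<bar>r\<bar>"]) auto

lemma square_summable_add:
  assumes "square_summable f" "square_summable g"
  shows "square_summable (\<lambda>x. f x + g x)"
proof -
  have "(\<lambda>x. 2 * (norm (f x))\<^sup>2 + 2 * (norm (g x))\<^sup>2) summable_on UNIV"
    using assms by (intro summable_on_add summable_on_cmult_right) (auto simp: square_summable_def)
  then show ?thesis
    unfolding square_summable_def
  proof (rule summable_on_comparison_test)
    fix x
    have "(norm (f x + g x))\<^sup>2 \<le> (norm (f x) + norm (g x))\<^sup>2"
      by (intro power_mono norm_triangle_ineq) simp
    also have "\<dots> \<le> 2 * (norm (f x))\<^sup>2 + 2 * (norm (g x))\<^sup>2"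
      using sum_squares_bound[of "norm (f x)" "norm (g x)"] by (simp add: power2_sum)
    finally show "(norm (f x + g x))\<^sup>2 \<le> 2 * (norm (f x))\<^sup>2 + 2 * (norm (g x))\<^sup>2" .
  qed simp
qed

lemma square_summable_uminus: "square_summable f \<Longrightarrow> square_summable (\<lambda>x. - f x)"
  by (simp add: square_summable_def)

lemma square_summable_diff:
  "square_summable f \<Longrightarrow> square_summable g \<Longrightarrow> square_summable (\<lambda>x. f x - g x)"
  using square_summable_add[OF _ square_summable_uminus, of f g] by simp

lemma square_summable_finite_support:
  assumes "finite S" "\<And>x. x \<notin> S \<Longrightarrow> f x = 0"
  shows "square_summable f"
  unfolding square_summable_def
  by (rule finite_nonzero_values_imp_summable_on, rule finite_subset[OF _ assms(1)])
    (use assms(2) in force)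

lemma square_summable_inner:
  fixes f g :: "'i \<Rightarrow> 'b::real_inner"
  assumes "square_summable f" "square_summable g"
  shows "(\<lambda>x. inner (f x) (g x)) summable_on UNIV"
proof (rule abs_summable_summable)
  have "(\<lambda>x. (norm (f x))\<^sup>2 + (norm (g x))\<^sup>2) summable_on UNIV"
    using assms by (intro summable_on_add) (auto simp: square_summable_def)
  then show "(\<lambda>x. norm (inner (f x) (g x))) summable_on UNIV"
  proof (rule summable_on_comparison_test)
    fix x
    have "\<bar>inner (f x) (g x)\<bar> \<le> norm (f x) * norm (g x)" by (rule Cauchy_Schwarz_ineq2)
    moreover have "2 * (norm (f x) * norm (g x)) \<le> (norm (f x))\<^sup>2 + (norm (g x))\<^sup>2"
      using sum_squares_bound[of "norm (f x)" "norm (g x)"] by simp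
    moreover have "0 \<le> norm (f x) * norm (g x)" by simp
    ultimately show "norm (inner (f x) (g x)) \<le> (norm (f x))\<^sup>2 + (norm (g x))\<^sup>2"
      unfolding real_norm_def by linarith
  qed simp
qed

typedef (overloaded) ('i, 'b::real_inner) ell2 = "{f :: 'i \<Rightarrow> 'b. square_summable f}"
  morphisms app Abs_ell2
  by (rule exI[of _ "\<lambda>_. 0"]) (simp add: square_summable_def)

setup_lifting type_definition_ell2

lemma square_summable_app: "square_summable (app \<psi>)"
  using app[of \<psi>] by simp

lemma app_Abs: "square_summable f \<Longrightarrow> app (Abs_ell2 f) = f"
  by (simp add: Abs_ell2_inverse)

lemma ell2_eqI: "(\<And>x. app \<psi> x = app \<phi> x) \<Longrightarrow> \<psi> = \<phi>"
  by (metis app_inject ext)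

instantiation ell2 :: (type, real_inner) real_vector
begin

lift_definition zero_ell2 :: "('a, 'b) ell2" is "\<lambda>_. 0"
  by (simp add: square_summable_def)

lift_definition plus_ell2 :: "('a, 'b) ell2 \<Rightarrow> ('a, 'b) ell2 \<Rightarrow> ('a, 'b) ell2" is "\<lambda>f g x. f x + g x"
  by (rule square_summable_add)

lift_definition uminus_ell2 :: "('a, 'b) ell2 \<Rightarrow> ('a, 'b) ell2" is "\<lambda>f x. - f x"
  by (rule square_summable_uminus)

lift_definition minus_ell2 :: "('a, 'b) ell2 \<Rightarrow> ('a, 'b) ell2 \<Rightarrow> ('a, 'b) ell2" is "\<lambda>f g x. f x - g x"
  by (rule square_summable_diff)

lift_definition scaleR_ell2 :: "real \<Rightarrow> ('a, 'b) ell2 \<Rightarrow> ('a, 'b) ell2" is "\<lambda>r f x. r *\<^sub>R f x"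
  by (rule square_summable_scaleR)

instance
  by standard (transfer; simp add: algebra_simps)+

end

lemma app_simps [simp]:
  "app 0 x = 0" "app (\<psi> + \<phi>) x = app \<psi> x + app \<phi> x" "app (- \<psi>) x = - app \<psi> x"
  "app (\<psi> - \<phi>) x = app \<psi> x - app \<phi> x" "app (r *\<^sub>R \<psi>) x = r *\<^sub>R app \<psi> x"
  by (simp_all add: zero_ell2.rep_eq plus_ell2.rep_eq uminus_ell2.rep_eq minus_ell2.rep_eq
      scaleR_ell2.rep_eq)

instantiation ell2 :: (type, real_inner) real_inner
begin

lift_definition inner_ell2 :: "('a, 'b) ell2 \<Rightarrow> ('a, 'b) ell2 \<Rightarrow> real"
  is "\<lambda>f g. \<Sum>\<^sub>\<infinity>x. inner (f x) (g x)" .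

definition norm_ell2_def: "norm (\<psi> :: ('a, 'b) ell2) = sqrt (inner \<psi> \<psi>)"
definition dist_ell2_def: "dist (\<psi> :: ('a, 'b) ell2) \<phi> = norm (\<psi> - \<phi>)"
definition sgn_ell2_def: "sgn (\<psi> :: ('a, 'b) ell2) = \<psi> /\<^sub>R norm \<psi>"
definition uniformity_ell2_def:
  "(uniformity :: (('a, 'b) ell2 \<times> ('a, 'b) ell2) filter)
    = (INF e\<in>{0 <..}. principal {(\<psi>, \<phi>). dist \<psi> \<phi> < e})"
definition open_ell2_def:
  "open (S :: ('a, 'b) ell2 set)
    \<longleftrightarrow> (\<forall>\<psi>\<in>S. eventually (\<lambda>(\<psi>', \<phi>). \<psi>' = \<psi> \<longrightarrow> \<phi> \<in> S) uniformity)"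

instance
proof
  fix \<psi> \<phi> \<eta> :: "('a, 'b) ell2" and r :: real
  show "inner \<psi> \<phi> = inner \<phi> \<psi>" by transfer (simp add: inner_commute)
  show "inner (\<psi> + \<phi>) \<eta> = inner \<psi> \<eta> + inner \<phi> \<eta>"
    by transfer (simp add: inner_add_left infsum_add square_summable_inner)
  show "inner (r *\<^sub>R \<psi>) \<phi> = r * inner \<psi> \<phi>"
    by transfer (simp add: infsum_cmult_right square_summable_inner)
  show "0 \<le> inner \<psi> \<psi>" by transfer (auto intro: infsum_nonneg)
  show "inner \<psi> \<psi> = 0 \<longleftrightarrow> \<psi> = 0"
  proof
    assume "inner \<psi> \<psi> = 0"
    then have "inner (app \<psi> x) (app \<psi> x) = 0" for x
      by (intro nonneg_infsum_le_0D[where A = UNIV and f = "\<lambda>x. inner (app \<psi> x) (app \<psi> x)"])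
        (auto simp: inner_ell2.rep_eq square_summable_inner square_summable_app)
    then show "\<psi> = 0" by (intro ell2_eqI) simp
  qed (simp add: inner_ell2.rep_eq)
qed (fact dist_ell2_def sgn_ell2_def uniformity_ell2_def open_ell2_def norm_ell2_def)+

end

lemma norm_ell2_sq: "(norm \<psi>)\<^sup>2 = (\<Sum>\<^sub>\<infinity>x. (norm (app \<psi> x))\<^sup>2)"
  by (simp add: power2_norm_eq_inner inner_ell2.rep_eq)

lemma summable_on_norm_app: "(\<lambda>x. (norm (app \<psi> x))\<^sup>2) summable_on UNIV"
  using square_summable_app[of \<psi>] by (simp add: square_summable_def)

lemma norm_ell2_dominated:
  assumes "\<And>x. norm (app \<phi> x) \<le> c * norm (app \<psi> x)" "c \<ge> 0"
  shows "norm \<phi> \<le> c * norm \<psi>"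
proof (rule power2_le_imp_le)
  have "(norm (app \<phi> x))\<^sup>2 \<le> c\<^sup>2 * (norm (app \<psi> x))\<^sup>2" for x
    using power_mono[OF assms(1)[of x], of 2] by (simp add: power_mult_distrib)
  then have "(norm \<phi>)\<^sup>2 \<le> (\<Sum>\<^sub>\<infinity>x. c\<^sup>2 * (norm (app \<psi> x))\<^sup>2)"
    unfolding norm_ell2_sq by (intro infsum_mono summable_on_norm_app summable_on_cmult_right)
  then show "(norm \<phi>)\<^sup>2 \<le> (c * norm \<psi>)\<^sup>2"
    by (simp add: norm_ell2_sq infsum_cmult_right summable_on_norm_app power_mult_distrib)
qed (use assms in simp)

lemma norm_ell2_eqI: "(\<And>x. norm (app \<phi> x) = norm (app \<psi> x)) \<Longrightarrow> norm \<phi> = norm \<psi>"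
  by (simp add: norm_ell2_def inner_ell2.rep_eq flip: power2_norm_eq_inner)

lemma sum_norm_app_le: "finite F \<Longrightarrow> (\<Sum>x\<in>F. (norm (app \<psi> x))\<^sup>2) \<le> (norm \<psi>)\<^sup>2"
  unfolding norm_ell2_sq by (rule finite_sum_le_infsum[OF summable_on_norm_app]) auto

lemma norm_app_le: "norm (app \<psi> x) \<le> norm \<psi>"
  using sum_norm_app_le[of "{x}" \<psi>] by (simp add: power2_le_iff_abs_le)

lemma norm_ell2_finite_support:
  assumes "finite S" "\<And>x. x \<notin> S \<Longrightarrow> app \<psi> x = 0"
  shows "(norm \<psi>)\<^sup>2 = (\<Sum>x\<in>S. (norm (app \<psi> x))\<^sup>2)"
proof -
  have "(norm \<psi>)\<^sup>2 = (\<Sum>\<^sub>\<infinity>x\<in>S. (norm (app \<psi> x))\<^sup>2)"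
    unfolding norm_ell2_sq by (rule infsum_cong_neutral) (use assms in auto)
  then show ?thesis using assms by simp
qed

lemma pointwise_limit_in_ell2:
  assumes lim: "\<And>x. (\<lambda>n. app (\<psi> n) x) \<longlonglongrightarrow> f x" and bound: "\<And>n. n \<ge> N \<Longrightarrow> norm (\<psi> n) \<le> B"
  obtains \<phi> where "app \<phi> = f" "norm \<phi> \<le> B"
proof -
  have sum_le: "(\<Sum>x\<in>F. (norm (f x))\<^sup>2) \<le> B\<^sup>2" if "finite F" for F
  proof (rule LIMSEQ_le_const2)
    show "(\<lambda>n. \<Sum>x\<in>F. (norm (app (\<psi> n) x))\<^sup>2) \<longlonglongrightarrow> (\<Sum>x\<in>F. (norm (f x))\<^sup>2)"
      by (intro tendsto_intros lim)
    have "(\<Sum>x\<in>F. (norm (app (\<psi> n) x))\<^sup>2) \<le> B\<^sup>2" if "n \<ge> N" for n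
      by (rule order_trans[OF sum_norm_app_le[OF \<open>finite F\<close>]]) (simp add: bound[OF that] power_mono)
    then show "\<exists>N. \<forall>n\<ge>N. (\<Sum>x\<in>F. (norm (app (\<psi> n) x))\<^sup>2) \<le> B\<^sup>2" by blast
  qed
  then have "square_summable f"
    unfolding square_summable_def
    by (intro nonneg_bdd_above_summable_on) (auto intro!: bdd_aboveI[of _ "B\<^sup>2"])
  then have app: "app (Abs_ell2 f) = f" by (rule app_Abs)
  have "norm (Abs_ell2 f) \<le> B"
  proof (rule power2_le_imp_le)
    show "(norm (Abs_ell2 f))\<^sup>2 \<le> B\<^sup>2"
      unfolding norm_ell2_sq
      by (rule infsum_le_finite_sums[OF summable_on_norm_app]) (simp add: app sum_le)
    show "0 \<le> B" using bound[of N] norm_ge_zero[of "\<psi> N"] by linarith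
  qed
  then show thesis by (rule that[OF app])
qed

lemma Cauchy_close_to_pointwise_limit:
  assumes "Cauchy \<psi>" and lim: "\<And>x. (\<lambda>n. app (\<psi> n) x) \<longlonglongrightarrow> f x" and "e > 0"
  shows "\<exists>N. \<forall>n\<ge>N. \<exists>\<phi>. app \<phi> = (\<lambda>x. app (\<psi> n) x - f x) \<and> norm \<phi> \<le> e"
proof -
  obtain N where close: "\<And>m n. m \<ge> N \<Longrightarrow> n \<ge> N \<Longrightarrow> norm (\<psi> m - \<psi> n) < e"
    using CauchyD[OF \<open>Cauchy \<psi>\<close> \<open>e > 0\<close>] by blast
  have "\<exists>\<phi>. app \<phi> = (\<lambda>x. app (\<psi> n) x - f x) \<and> norm \<phi> \<le> e" if "n \<ge> N" for n
  proof (rule pointwise_limit_in_ell2)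
    show "(\<lambda>m. app (\<psi> n - \<psi> m) x) \<longlonglongrightarrow> app (\<psi> n) x - f x" for x
      by (simp add: tendsto_diff lim)
    show "norm (\<psi> n - \<psi> m) \<le> e" if "m \<ge> N" for m
      using close[OF \<open>n \<ge> N\<close> that] by simp
  qed blast
  then show ?thesis by blast
qed

instance ell2 :: (type, "{real_inner, banach}") banach
proof
  fix \<psi> :: "nat \<Rightarrow> ('a, 'b) ell2" assume Cauchy: "Cauchy \<psi>"
  define f where "f x = lim (\<lambda>n. app (\<psi> n) x)" for x
  have lim: "(\<lambda>n. app (\<psi> n) x) \<longlonglongrightarrow> f x" for x
  proof -
    have "dist (app (\<psi> m) x) (app (\<psi> n) x) \<le> dist (\<psi> m) (\<psi> n)" for m n
      using norm_app_le[of "\<psi> m - \<psi> n" x] by (simp add: dist_norm)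
    then have "Cauchy (\<lambda>n. app (\<psi> n) x)"
      using Cauchy unfolding Cauchy_def by (meson le_less_trans)
    then show ?thesis unfolding f_def by (simp add: Cauchy_convergent flip: convergent_LIMSEQ_iff)
  qed
  obtain N \<phi> where \<phi>: "app \<phi> = (\<lambda>x. app (\<psi> N) x - f x)"
    using Cauchy_close_to_pointwise_limit[OF Cauchy lim, of 1] by auto
  have "\<psi> \<longlonglongrightarrow> \<psi> N - \<phi>"
  proof (rule LIMSEQ_I)
    fix e :: real assume "e > 0"
    then obtain M where M: "\<forall>n\<ge>M. \<exists>\<eta>. app \<eta> = (\<lambda>x. app (\<psi> n) x - f x) \<and> norm \<eta> \<le> e / 2"
      using Cauchy_close_to_pointwise_limit[OF Cauchy lim, of "e / 2"] by auto
    have "norm (\<psi> n - (\<psi> N - \<phi>)) < e" if "n \<ge> M" for n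
    proof -
      obtain \<eta> where \<eta>: "app \<eta> = (\<lambda>x. app (\<psi> n) x - f x)" "norm \<eta> \<le> e / 2"
        using M \<open>n \<ge> M\<close> by blast
      have "\<psi> n - (\<psi> N - \<phi>) = \<eta>" by (rule ell2_eqI) (simp add: \<eta>(1) \<phi>)
      then show ?thesis using \<eta>(2) \<open>e > 0\<close> by simp
    qed
    then show "\<exists>M. \<forall>n\<ge>M. norm (\<psi> n - (\<psi> N - \<phi>)) < e" by blast
  qed
  then show "convergent \<psi>" by (rule convergentI)
qed

definition cut :: "'i set \<Rightarrow> ('i \<Rightarrow> 'b::real_inner) \<Rightarrow> ('i, 'b) ell2" where
  "cut S f = Abs_ell2 (\<lambda>x. if x \<in> S then f x else 0)"

lemma app_cut_finite: "finite S \<Longrightarrow> app (cut S f) = (\<lambda>x. if x \<in> S then f x else 0)"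
  unfolding cut_def by (rule app_Abs) (rule square_summable_finite_support[of S], auto)

lemma app_cut [simp]: "app (cut S (app \<psi>)) = (\<lambda>x. if x \<in> S then app \<psi> x else 0)"
  unfolding cut_def
  by (rule app_Abs, rule square_summable_dominated[OF square_summable_app[of \<psi>], of _ 1]) auto

lemma norm_cut_le: "norm (cut S (app \<psi>)) \<le> norm \<psi>"
  using norm_ell2_dominated[of "cut S (app \<psi>)" 1 \<psi>] by auto

lemma norm_cut_unit:
  assumes "finite S" "\<And>x. norm (f x) = 1"
  shows "norm (cut S f) = sqrt (card S)"
proof -
  have "(norm (cut S f))\<^sup>2 = (\<Sum>x\<in>S. 1)"
    using assms by (subst norm_ell2_finite_support[of S]) (auto simp: app_cut_finite)
  then show ?thesis by (simp add: real_sqrt_unique)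
qed

lemma bounded_linear_cut: "bounded_linear (\<lambda>\<psi>. cut S (app \<psi>))"
  by (rule bounded_linear_intro[of _ 1]) (auto intro!: ell2_eqI simp: norm_cut_le)

lemma compact_operator_cut:
  fixes S :: "'i set"
  assumes "finite S"
  shows "compact_operator (\<lambda>\<psi> :: ('i, 'b::{real_inner,heine_borel}) ell2. cut S (app \<psi>))"
  unfolding compact_operator_def
proof (intro conjI allI impI bounded_linear_cut)
  fix \<psi> :: "nat \<Rightarrow> ('i, 'b) ell2" assume "bounded (range \<psi>)"
  then obtain B where bound: "\<And>n. norm (\<psi> n) \<le> B" by (auto simp: bounded_iff)
  have "bounded ((\<lambda>f. f x) ` range (\<lambda>n. app (\<psi> n)))" for x
    using order_trans[OF norm_app_le bound] by (intro boundedI[of _ B]) auto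
  with compact_lemma_general[of S "\<lambda>f x. f x" "\<lambda>n. app (\<psi> n)" "\<lambda>f. f"] assms
  have "\<forall>d\<subseteq>S. \<exists>l. \<exists>r::nat \<Rightarrow> nat. strict_mono r
      \<and> (\<forall>e>0. eventually (\<lambda>n. \<forall>x\<in>d. dist (app (\<psi> (r n)) x) (l x) < e) sequentially)"
    by simp
  then obtain l and r :: "nat \<Rightarrow> nat" where r: "strict_mono r"
    and close: "\<forall>e>0. eventually (\<lambda>n. \<forall>x\<in>S. dist (app (\<psi> (r n)) x) (l x) < e) sequentially"
    by blast
  have lim: "(\<lambda>n. app (\<psi> (r n)) x) \<longlonglongrightarrow> l x" if "x \<in> S" for x
    by (rule tendstoI, rule eventually_mono[OF close[rule_format]]) (use that in auto)
  have "(norm (cut S (app (\<psi> (r n))) - cut S l))\<^sup>2 = (\<Sum>x\<in>S. (norm (app (\<psi> (r n)) x - l x))\<^sup>2)" for n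
    by (subst norm_ell2_finite_support[OF assms]) (auto simp: app_cut_finite[OF assms])
  moreover have "(\<lambda>n. \<Sum>x\<in>S. (norm (app (\<psi> (r n)) x - l x))\<^sup>2) \<longlonglongrightarrow> (\<Sum>x\<in>S. (norm (l x - l x))\<^sup>2)"
    by (intro tendsto_intros lim)
  ultimately have "(\<lambda>n. (norm (cut S (app (\<psi> (r n))) - cut S l))\<^sup>2) \<longlonglongrightarrow> 0" by simp
  from tendsto_real_sqrt[OF this] have "(\<lambda>n. cut S (app (\<psi> (r n)))) \<longlonglongrightarrow> cut S l"
    by (simp add: tendsto_norm_zero_iff LIM_zero_iff)
  then show "\<exists>r::nat \<Rightarrow> nat. strict_mono r \<and> convergent (\<lambda>n. cut S (app (\<psi> (r n))))"
    using r convergentI by blast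
qed

lemma exists_finite_cut_close:
  assumes "e > 0"
  obtains S where "finite S" "norm (\<psi> - cut S (app \<psi>)) < e"
proof -
  obtain S where S: "finite S" "dist (\<Sum>x\<in>S. (norm (app \<psi> x))\<^sup>2) ((norm \<psi>)\<^sup>2) \<le> (e / 2)\<^sup>2"
    using infsum_finite_approximation[OF summable_on_norm_app, of "(e / 2)\<^sup>2" \<psi>] assms
    by (auto simp: norm_ell2_sq)
  have "(norm (\<psi> - cut S (app \<psi>)))\<^sup>2 = (\<Sum>\<^sub>\<infinity>x\<in>- S. (norm (app \<psi> x))\<^sup>2)"
    unfolding norm_ell2_sq by (rule infsum_cong_neutral) auto
  also have "\<dots> = (norm \<psi>)\<^sup>2 - (\<Sum>x\<in>S. (norm (app \<psi> x))\<^sup>2)"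
    unfolding norm_ell2_sq Compl_eq_Diff_UNIV
    using S(1) by (subst infsum_Diff) (auto simp: summable_on_norm_app)
  also have "\<dots> \<le> (e / 2)\<^sup>2" using S(2) by (simp add: dist_real_def)
  finally have "norm (\<psi> - cut S (app \<psi>)) \<le> e / 2" by (rule power2_le_imp_le) (use assms in simp)
  then show thesis using that[OF S(1)] assms by simp
qed

lemma weakly_null_if_locally_zero:
  assumes bound: "\<And>n. norm (\<psi> n) \<le> 1" and zero: "\<And>x. eventually (\<lambda>n. app (\<psi> n) x = 0) sequentially"
  shows "(\<lambda>n. inner (\<psi> n) \<phi>) \<longlonglongrightarrow> 0"
proof (rule tendstoI)
  fix e :: real assume "e > 0"
  then obtain S where S: "finite S" "norm (\<phi> - cut S (app \<phi>)) < e" by (rule exists_finite_cut_close)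
  have "eventually (\<lambda>n. \<forall>x\<in>S. app (\<psi> n) x = 0) sequentially"
    using zero by (intro eventually_ball_finite[OF S(1)]) blast
  then show "eventually (\<lambda>n. dist (inner (\<psi> n) \<phi>) 0 < e) sequentially"
  proof eventually_elim
    case (elim n)
    then have "inner (\<psi> n) (cut S (app \<phi>)) = 0"
      unfolding inner_ell2.rep_eq by (intro infsum_0) auto
    then have "inner (\<psi> n) \<phi> = inner (\<psi> n) (\<phi> - cut S (app \<phi>))" by (simp add: inner_diff_right)
    then have "\<bar>inner (\<psi> n) \<phi>\<bar> \<le> norm (\<psi> n) * norm (\<phi> - cut S (app \<phi>))"
      by (simp add: Cauchy_Schwarz_ineq2)
    also have "\<dots> \<le> 1 * norm (\<phi> - cut S (app \<phi>))" by (intro mult_right_mono bound) simp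
    finally show ?case using S(2) by simp
  qed
qed

section \<open>Finite-dimensional spaces of states\<close>

type_synonym wave = "(int, complex \<times> complex) ell2"

lemma l2_eq_range_app: "l2 = range app"
  by (simp add: l2_def square_summable_def type_definition.Rep_range[OF type_definition_ell2])

lemma norm_csmult: "norm (csmult z v) = cmod z * norm v"
  by (simp add: csmult_def norm_prod_def norm_mult power_mult_distrib real_sqrt_mult
      flip: distrib_left)

lift_definition scaleC :: "complex \<Rightarrow> ('i, complex \<times> complex) ell2 \<Rightarrow> ('i, complex \<times> complex) ell2"
  is "\<lambda>z \<psi> x. csmult z (\<psi> x)"
  by (rule square_summable_dominated) (auto simp: norm_csmult)

lemma app_scaleC [simp]: "app (scaleC z \<psi>) x = csmult z (app \<psi> x)"
  by (simp add: scaleC.rep_eq)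

interpretation ell2: complex_scaling "scaleC :: complex \<Rightarrow> ('i, complex \<times> complex) ell2 \<Rightarrow> _"
proof
  fix r :: real and z w and \<psi> \<phi> :: "('i, complex \<times> complex) ell2"
  show "scaleC (complex_of_real r) \<psi> = r *\<^sub>R \<psi>"
    by (rule ell2_eqI) (simp add: csmult_def prod_eq_iff scaleR_conv_of_real)
  show "scaleC z (scaleC w \<psi>) = scaleC (z * w) \<psi>"
    by (rule ell2_eqI) (simp add: csmult_def)
  show "scaleC (z + w) \<psi> = scaleC z \<psi> + scaleC w \<psi>"
    by (rule ell2_eqI) (simp add: csmult_def distrib_right)
  show "scaleC z (\<psi> + \<phi>) = scaleC z \<psi> + scaleC z \<phi>"
    by (rule ell2_eqI) (simp add: csmult_def distrib_left)
  show "inner (scaleC z \<psi>) \<phi> = inner \<psi> (scaleC (cnj z) \<phi>)"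
    unfolding inner_ell2.rep_eq
    by (rule infsum_cong) (simp add: csmult_def inner_prod_def inner_complex_def algebra_simps)
qed

global_interpretation state: vector_space "\<lambda>c (\<psi>::state) x. csmult c (\<psi> x)"
  by standard (auto simp: csmult_def algebra_simps fun_eq_iff)

lemma sum_state_apply: "(\<Sum>i\<in>A. f i) x = (\<Sum>i\<in>A. (f i :: state) x)"
  by (induction A rule: infinite_finite_induct) auto

lemma fin_dim_iff_span: "fin_dim E \<longleftrightarrow> (\<exists>F. finite F \<and> E \<subseteq> state.span F)"
proof -
  have sum: "(\<lambda>x. \<Sum>\<phi>\<in>F. csmult (c \<phi>) (\<phi> x)) = (\<Sum>\<phi>\<in>F. (\<lambda>x. csmult (c \<phi>) (\<phi> x)))"
    for F :: "state set" and c
    by (rule ext) (subst sum_state_apply, rule refl)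
  show ?thesis unfolding fin_dim_def sum
    by (rule ex_cong1, rule conj_cong) (auto simp: state.span_finite)
qed

lemma app_add_fun: "app (\<psi> + \<phi>) = app \<psi> + app \<phi>"
  by auto

lemma csmult_app: "(\<lambda>x. csmult c (app \<psi> x)) = app (scaleC c \<psi>)"
  by auto

lemma app_span_subset: "app ` span B \<subseteq> state.span (app ` B)" for B :: "wave set"
proof -
  have "span B \<subseteq> {\<psi>. app \<psi> \<in> state.span (app ` B)}"
  proof (rule span_minimal)
    show "B \<subseteq> {\<psi>. app \<psi> \<in> state.span (app ` B)}" by (auto intro: state.span_base)
    show "subspace {\<psi>. app \<psi> \<in> state.span (app ` B)}"
    proof (rule subspaceI; clarsimp)
      show "app 0 \<in> state.span (app ` B)"
        using state.span_zero by (simp add: zero_ell2.rep_eq zero_fun_def)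
      show "app (\<psi> + \<phi>) \<in> state.span (app ` B)"
        if "app \<psi> \<in> state.span (app ` B)" "app \<phi> \<in> state.span (app ` B)" for \<psi> \<phi>
        using that by (simp add: app_add_fun state.span_add)
      show "app (r *\<^sub>R \<psi>) \<in> state.span (app ` B)" if "app \<psi> \<in> state.span (app ` B)" for r \<psi>
        using state.span_scale[OF that, of "of_real r"]
        by (simp add: csmult_app ell2.scaleC_of_real)
    qed
  qed
  then show ?thesis by blast
qed

lemma state_span_app_subset:
  "state.span (app ` B) \<subseteq> app ` span (B \<union> scaleC \<i> ` B)" for B :: "wave set"
proof (rule state.span_minimal)
  let ?S = "span (B \<union> scaleC \<i> ` B)"
  show "app ` B \<subseteq> app ` ?S" by (auto intro: span_base)
  have "scaleC \<i> ` ?S \<subseteq> ?S"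
  proof -
    have "scaleC \<i> ` (B \<union> scaleC \<i> ` B) \<subseteq> ?S"
    proof (clarsimp simp: image_Un image_image ell2.scaleC_scaleC, intro conjI subsetI; clarsimp)
      fix \<psi> assume \<psi>: "\<psi> \<in> B"
      show "scaleC \<i> \<psi> \<in> ?S" using \<psi> by (auto intro: span_base)
      show "scaleC (- 1) \<psi> \<in> ?S"
        using \<psi> by (auto simp: ell2.scaleC.minus_left intro: span_base span_neg)
    qed
    then show ?thesis
      using linear_span_image[OF bounded_linear.linear[OF ell2.scaleC.bounded_linear_right[of \<i>]]]
        span_minimal subspace_span
      by metis
  qed
  then have scaleC_S: "scaleC c \<psi> \<in> ?S" if "\<psi> \<in> ?S" for c \<psi>
  proof -
    have "scaleC c \<psi> = Re c *\<^sub>R \<psi> + Im c *\<^sub>R scaleC \<i> \<psi>"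
      unfolding ell2.scaleC_of_real[symmetric] ell2.scaleC_scaleC ell2.scaleC_add_left[symmetric]
      by (rule arg_cong[of _ _ "\<lambda>c. scaleC c \<psi>"]) (simp add: complex_eq_iff)
    then show ?thesis using that \<open>scaleC \<i> ` ?S \<subseteq> ?S\<close> by (auto intro!: span_add span_scale)
  qed
  show "state.subspace (app ` ?S)"
    unfolding state.subspace_def
  proof (intro conjI ballI allI)
    show "0 \<in> app ` ?S"
      by (rule image_eqI[of _ _ 0]) (auto simp: span_zero)
    show "\<psi> + \<phi> \<in> app ` ?S" if "\<psi> \<in> app ` ?S" "\<phi> \<in> app ` ?S" for \<psi> \<phi>
      using that by (auto simp flip: app_add_fun intro: span_add)
    show "(\<lambda>x. csmult c (\<psi> x)) \<in> app ` ?S" if "\<psi> \<in> app ` ?S" for c \<psi>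
      using that scaleC_S by (auto simp: csmult_app)
  qed
qed

lemma fin_dim_app_iff: "fin_dim (app ` V) \<longleftrightarrow> (\<exists>B. finite B \<and> V \<subseteq> span B)" for V :: "wave set"
proof
  assume "fin_dim (app ` V)"
  then obtain F where F: "finite F" "app ` V \<subseteq> state.span F" by (auto simp: fin_dim_iff_span)
  obtain E where E: "E \<subseteq> app ` V" "state.independent E" "app ` V \<subseteq> state.span E"
    using state.maximal_independent_subset by blast
  then have "finite E" using state.independent_span_bound[OF F(1) E(2)] F(2) by blast
  then obtain B where B: "finite B" "E = app ` B" using E(1) by (metis finite_subset_image)
  have "app ` V \<subseteq> app ` span (B \<union> scaleC \<i> ` B)"
    using E(3) state_span_app_subset unfolding B(2) by blast
  then have "V \<subseteq> span (B \<union> scaleC \<i> ` B)" by (auto simp: app_inject)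
  then show "\<exists>B. finite B \<and> V \<subseteq> span B" using B(1) by (intro exI[of _ "B \<union> scaleC \<i> ` B"]) auto
next
  assume "\<exists>B. finite B \<and> V \<subseteq> span B"
  then obtain B where "finite B" "V \<subseteq> span B" by blast
  then show "fin_dim (app ` V)"
    using app_span_subset[of B] unfolding fin_dim_iff_span by (intro exI[of _ "app ` B"]) blast
qed

section \<open>The walk operator\<close>

lemma square_summable_translate:
  fixes f :: "int \<Rightarrow> 'b::real_normed_vector"
  assumes "square_summable f"
  shows "square_summable (\<lambda>x. f (x + k))"
  using assms summable_on_reindex_bij_betw[OF bij_plus_right, of "\<lambda>x. (norm (f x))\<^sup>2" k]
  by (simp add: square_summable_def)

lemma infsum_translate: "(\<Sum>\<^sub>\<infinity>x. f (x + k :: int)) = (\<Sum>\<^sub>\<infinity>x. f x)"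
  by (rule infsum_reindex_bij_betw) (rule bij_plus_right)

lift_definition translate :: "int \<Rightarrow> wave \<Rightarrow> wave" is "\<lambda>k \<psi> x. \<psi> (x + k)"
  by (rule square_summable_translate)

lemma norm_translate: "norm (translate k \<psi>) = norm \<psi>"
  using infsum_translate[of "\<lambda>x. inner (app \<psi> x) (app \<psi> x)" k]
  by (simp add: norm_ell2_def inner_ell2.rep_eq translate.rep_eq)

lemma norm_prod_sq: "(norm v)\<^sup>2 = (norm (fst v))\<^sup>2 + (norm (snd v))\<^sup>2"
  by (simp add: norm_prod_def)

lemma square_summable_fst: "square_summable f \<Longrightarrow> square_summable (\<lambda>x. fst (f x))"
  and square_summable_snd: "square_summable f \<Longrightarrow> square_summable (\<lambda>x. snd (f x))"
  by (erule square_summable_dominated[of _ _ 1]; simp add: norm_prod_def)+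

text \<open>Conjugation by \<open>twist 1\<close> turns the shift operator into a constant coin.\<close>

lift_definition twist :: "int \<Rightarrow> wave \<Rightarrow> wave" is "\<lambda>k \<psi> x. (fst (\<psi> x), snd (\<psi> (x + k)))"
proof -
  fix k and \<psi> :: state assume \<psi>: "square_summable \<psi>"
  show "square_summable (\<lambda>x. (fst (\<psi> x), snd (\<psi> (x + k))))"
    using square_summable_fst[OF \<psi>] square_summable_snd[OF square_summable_translate[OF \<psi>, of k]]
    by (simp add: square_summable_def norm_prod_sq summable_on_add)
qed

lemma norm_twist: "norm (twist k \<psi>) = norm \<psi>"
proof -
  note summable = square_summable_fst[OF square_summable_app[of \<psi>]]
    square_summable_snd[OF square_summable_app[of \<psi>]]
    square_summable_snd[OF square_summable_translate[OF square_summable_app[of \<psi>], of k]]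
  have "(norm (twist k \<psi>))\<^sup>2 = (norm \<psi>)\<^sup>2"
    using summable infsum_translate[of "\<lambda>x. (norm (snd (app \<psi> x)))\<^sup>2" k]
    by (simp add: norm_ell2_sq twist.rep_eq norm_prod_sq infsum_add square_summable_def)
  then show ?thesis by simp
qed

lemma twist_twist: "twist j (twist k \<psi>) = twist (j + k) \<psi>"
  by (rule ell2_eqI) (simp add: twist.rep_eq ac_simps)

lemma twist_0: "twist 0 \<psi> = \<psi>"
  by (rule ell2_eqI) (simp add: twist.rep_eq)

definition coin_op :: "(int \<Rightarrow> real) \<Rightarrow> (int \<Rightarrow> real) \<Rightarrow> (int \<Rightarrow> complex) \<Rightarrow> wave \<Rightarrow> wave" where
  "coin_op a1 a2 b \<psi> = Abs_ell2 (Coin a1 a2 b (app \<psi>))"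

definition shift_op :: "real \<Rightarrow> complex \<Rightarrow> wave \<Rightarrow> wave" where
  "shift_op p q \<psi> = Abs_ell2 (Gam p q (app \<psi>))"

locale coin =
  fixes a1 a2 :: "int \<Rightarrow> real" and b :: "int \<Rightarrow> complex"
  assumes norm_row1: "(a1 x)\<^sup>2 + (norm (b x))\<^sup>2 = 1"
    and norm_row2: "(a2 x)\<^sup>2 + (norm (b x))\<^sup>2 = 1"
    and rows_orthogonal: "b x * complex_of_real (a1 x + a2 x) = 0"
begin

lemma norm_Coin: "norm (Coin a1 a2 b \<psi> x) = norm (\<psi> x)"
proof (rule power2_eq_imp_eq)
  define u v where "u = fst (\<psi> x)" and "v = snd (\<psi> x)"
  have "(norm (of_real (a1 x) * u + cnj (b x) * v))\<^sup>2 + (norm (b x * u + of_real (a2 x) * v))\<^sup>2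
      = ((a1 x)\<^sup>2 + (norm (b x))\<^sup>2) * (norm u)\<^sup>2 + ((a2 x)\<^sup>2 + (norm (b x))\<^sup>2) * (norm v)\<^sup>2
        + 2 * Re (u * cnj v * (b x * of_real (a1 x + a2 x)))"
    unfolding cmod_power2 by (simp add: power2_eq_square algebra_simps)
  then show "(norm (Coin a1 a2 b \<psi> x))\<^sup>2 = (norm (\<psi> x))\<^sup>2"
    unfolding norm_row1 norm_row2 rows_orthogonal by (simp add: norm_prod_def Coin_def u_def v_def)
qed auto

lemma Coin_Coin: "Coin a1 a2 b (Coin a1 a2 b \<psi>) = \<psi>"
proof
  fix x
  have row1: "of_real (a1 x) * of_real (a1 x) + cnj (b x) * b x = 1"
    and row2: "of_real (a2 x) * of_real (a2 x) + cnj (b x) * b x = 1"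
    using arg_cong[OF norm_row1, of complex_of_real x] arg_cong[OF norm_row2, of complex_of_real x]
    unfolding of_real_add complex_norm_square by (simp_all add: power2_eq_square mult.commute)
  have orth: "b x * of_real (a1 x) + of_real (a2 x) * b x = 0"
    using rows_orthogonal[of x] by (simp add: algebra_simps)
  have orth_cnj: "of_real (a1 x) * cnj (b x) + cnj (b x) * of_real (a2 x) = 0"
    using arg_cong[OF orth, of cnj] by (simp add: algebra_simps)
  have "of_real (a1 x) * (of_real (a1 x) * u + cnj (b x) * v)
       + cnj (b x) * (b x * u + of_real (a2 x) * v)
     = (of_real (a1 x) * of_real (a1 x) + cnj (b x) * b x) * u
       + (of_real (a1 x) * cnj (b x) + cnj (b x) * of_real (a2 x)) * v"
    "b x * (of_real (a1 x) * u + cnj (b x) * v) + of_real (a2 x) * (b x * u + of_real (a2 x) * v)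
     = (b x * of_real (a1 x) + of_real (a2 x) * b x) * u
       + (of_real (a2 x) * of_real (a2 x) + cnj (b x) * b x) * v" for u v
    by (simp_all add: algebra_simps)
  then show "Coin a1 a2 b (Coin a1 a2 b \<psi>) x = \<psi> x"
    by (simp add: Coin_def row1 row2 orth orth_cnj)
qed

lemma app_coin_op: "app (coin_op a1 a2 b \<psi>) = Coin a1 a2 b (app \<psi>)"
  unfolding coin_op_def
  by (rule app_Abs, rule square_summable_dominated[OF square_summable_app[of \<psi>], of _ 1])
    (simp add: norm_Coin)

lemma norm_coin_op: "norm (coin_op a1 a2 b \<psi>) = norm \<psi>"
  by (rule norm_ell2_eqI) (simp add: app_coin_op norm_Coin)

lemma coin_op_coin_op: "coin_op a1 a2 b (coin_op a1 a2 b \<psi>) = \<psi>"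
  by (rule ell2_eqI) (simp add: app_coin_op Coin_Coin)

end

locale walk = coin a1 a2 b
  for p :: real and q :: complex and a1 a2 :: "int \<Rightarrow> real" and b :: "int \<Rightarrow> complex" +
  assumes norm_p_q: "p\<^sup>2 + (norm q)\<^sup>2 = 1"
begin

sublocale shift: coin "\<lambda>_. p" "\<lambda>_. - p" "\<lambda>_. cnj q"
  by unfold_locales (use norm_p_q in simp_all)

lemma Gam_eq_twisted_coin:
  "Gam p q (app \<psi>) = app (twist (- 1) (coin_op (\<lambda>_. p) (\<lambda>_. - p) (\<lambda>_. cnj q) (twist 1 \<psi>)))"
  by (auto simp: Gam_def Coin_def twist.rep_eq shift.app_coin_op)

lemma shift_op_eq:
  "shift_op p q \<psi> = twist (- 1) (coin_op (\<lambda>_. p) (\<lambda>_. - p) (\<lambda>_. cnj q) (twist 1 \<psi>))"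
  unfolding shift_op_def Gam_eq_twisted_coin by (rule app_inverse)

lemma app_shift_op: "app (shift_op p q \<psi>) = Gam p q (app \<psi>)"
  by (simp add: shift_op_eq Gam_eq_twisted_coin)

lemma norm_shift_op: "norm (shift_op p q \<psi>) = norm \<psi>"
  by (simp add: shift_op_eq norm_twist shift.norm_coin_op)

lemma shift_op_shift_op: "shift_op p q (shift_op p q \<psi>) = \<psi>"
  by (simp add: shift_op_eq twist_twist twist_0 shift.coin_op_coin_op)

lemma shift_op_diff: "shift_op p q (\<psi> - \<phi>) = shift_op p q \<psi> - shift_op p q \<phi>"
  by (rule ell2_eqI) (simp add: app_shift_op Gam_def algebra_simps)

definition step :: "wave \<Rightarrow> wave" where
  "step \<psi> = shift_op p q (coin_op a1 a2 b \<psi>)"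

definition step_inv :: "wave \<Rightarrow> wave" where
  "step_inv \<psi> = coin_op a1 a2 b (shift_op p q \<psi>)"

lemma app_step: "app (step \<psi>) = Gam p q (Coin a1 a2 b (app \<psi>))"
  by (simp add: step_def app_shift_op app_coin_op)

lemma app_step_inv: "app (step_inv \<psi>) = Coin a1 a2 b (Gam p q (app \<psi>))"
  by (simp add: step_inv_def app_shift_op app_coin_op)

sublocale unitary_operator scaleC step step_inv
proof
  fix \<psi> \<phi> z
  show "step (\<psi> + \<phi>) = step \<psi> + step \<phi>"
    by (rule ell2_eqI) (simp add: app_step Gam_def Coin_def, simp add: algebra_simps)
  show "step (scaleC z \<psi>) = scaleC z (step \<psi>)"
    by (rule ell2_eqI) (simp add: app_step Gam_def Coin_def csmult_def, simp add: algebra_simps)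
  show "norm (step \<psi>) = norm \<psi>" by (simp add: step_def norm_shift_op norm_coin_op)
  show "step (step_inv \<psi>) = \<psi>" "step_inv (step \<psi>) = \<psi>"
    by (simp_all add: step_def step_inv_def shift_op_shift_op coin_op_coin_op)
qed

lemma app_T: "app (T z \<psi>) x = Gam p q (Coin a1 a2 b (app \<psi>)) x - csmult z (app \<psi> x)"
  by (simp add: T_def app_step)

lemma app_T_local:
  assumes "\<And>y. \<bar>y - x\<bar> \<le> 1 \<Longrightarrow> app \<psi> y = app \<phi> y"
  shows "app (T z \<psi>) x = app (T z \<phi>) x"
  using assms[of "x - 1"] assms[of x] assms[of "x + 1"] by (simp add: app_T Gam_def Coin_def)

lemma T_cut:
  assumes "\<And>x y. app \<psi> x \<noteq> 0 \<Longrightarrow> \<bar>x - y\<bar> \<le> 1 \<Longrightarrow> x \<in> S \<longleftrightarrow> y \<in> S"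
  shows "T z (cut S (app \<psi>)) = cut S (app (T z \<psi>))"
proof (rule ell2_eqI)
  fix y
  show "app (T z (cut S (app \<psi>))) y = app (cut S (app (T z \<psi>))) y"
  proof (cases "y \<in> S")
    case True
    have "app (T z (cut S (app \<psi>))) y = app (T z \<psi>) y"
      by (rule app_T_local) (use assms True in auto)
    then show ?thesis using True by simp
  next
    case False
    have "app (T z (cut S (app \<psi>))) y = app (T z 0) y"
      by (rule app_T_local) (use assms False in auto)
    then show ?thesis using False by (simp add: T.zero)
  qed
qed

lemma spec_iff: "z \<in> spec (Gam p q \<circ> Coin a1 a2 b) \<longleftrightarrow> \<not> bounded_below (T z)"
proof -
  let ?f = "\<lambda>\<psi> x. (Gam p q \<circ> Coin a1 a2 b) \<psi> x - csmult z (\<psi> x)"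
  have bij_app: "bij_betw app UNIV l2"
    by (simp add: bij_betw_def inj_on_def app_inject l2_eq_range_app)
  have intertwined: "?f \<circ> app = app \<circ> T z" by (auto simp: fun_eq_iff app_T)
  have "bij_betw ?f l2 l2 \<longleftrightarrow> bij_betw (?f \<circ> app) UNIV l2" by (rule bij_betw_comp_iff[OF bij_app])
  also have "\<dots> \<longleftrightarrow> bij (T z)"
    unfolding intertwined by (rule bij_betw_comp_iff2[OF bij_app, symmetric]) simp
  finally show ?thesis by (simp add: spec_def bij_T_iff_bounded_below)
qed

lemma eigenspace_eq: "eigenspace (Gam p q \<circ> Coin a1 a2 b) z = app ` {\<psi>. T z \<psi> = 0}"
proof -
  have "T z \<psi> = 0 \<longleftrightarrow> Gam p q (Coin a1 a2 b (app \<psi>)) = (\<lambda>x. csmult z (app \<psi> x))" for \<psi>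
  proof -
    have "T z \<psi> = 0 \<longleftrightarrow> app (T z \<psi>) = app 0" by (simp only: app_inject)
    then show ?thesis by (simp add: fun_eq_iff app_T)
  qed
  then show ?thesis unfolding eigenspace_def l2_eq_range_app by auto
qed

lemma isolated_in_spectrum_iff:
  assumes "z \<in> spec (Gam p q \<circ> Coin a1 a2 b)"
  shows "isolated_in_spectrum z \<longleftrightarrow> (\<exists>e>0. ball z e \<inter> spec (Gam p q \<circ> Coin a1 a2 b) = {z})"
proof -
  have "ball z e \<inter> spec (Gam p q \<circ> Coin a1 a2 b) = {z}
      \<longleftrightarrow> (\<forall>w. w \<noteq> z \<longrightarrow> cmod (w - z) < e \<longrightarrow> bounded_below (T w))" if "e > 0" for e
    using assms that by (auto simp: set_eq_iff spec_iff dist_norm norm_minus_commute)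
  then show ?thesis unfolding isolated_in_spectrum_def by blast
qed

lemma disc_spec_iff:
  "z \<in> disc_spec (Gam p q \<circ> Coin a1 a2 b)
    \<longleftrightarrow> \<not> bounded_below (T z) \<and> isolated_in_spectrum z \<and> finite_multiplicity z"
proof -
  have "eigenspace (Gam p q \<circ> Coin a1 a2 b) z \<noteq> {\<lambda>_. (0, 0)}"
    if z: "\<not> bounded_below (T z)" "isolated_in_spectrum z"
  proof -
    obtain \<psi> where \<psi>: "\<psi> \<noteq> 0" "T z \<psi> = 0" using isolated_imp_eigenvector[OF z] by blast
    have "app (0 :: wave) = (\<lambda>_. (0, 0))" by (simp add: zero_ell2.rep_eq zero_prod_def)
    then have "app \<psi> \<noteq> (\<lambda>_. (0, 0))" using app_inject[of \<psi> 0] \<psi>(1) by simp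
    then show ?thesis using \<psi>(2) by (auto simp: eigenspace_eq)
  qed
  then show ?thesis
    unfolding disc_spec_def mem_Collect_eq finite_multiplicity_def
    using isolated_in_spectrum_iff[of z] by (auto simp: spec_iff eigenspace_eq fin_dim_app_iff)
qed

lemma ess_spec_iff:
  "z \<in> ess_spec (Gam p q \<circ> Coin a1 a2 b)
    \<longleftrightarrow> \<not> bounded_below (T z) \<and> \<not> (isolated_in_spectrum z \<and> finite_multiplicity z)"
  by (auto simp: ess_spec_def disc_spec_iff spec_iff)

lemma weyl_sequence_imp_ess_spec:
  "weyl_sequence z \<psi> \<Longrightarrow> z \<in> ess_spec (Gam p q \<circ> Coin a1 a2 b)"
  using weyl_sequence_imp_not_bounded_below weyl_sequence_imp_not_discrete
  by (auto simp: ess_spec_iff)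

lemma bounded_below_mod_compact_imp_not_ess_spec:
  "bounded_below_mod_compact (T z) \<Longrightarrow> z \<notin> ess_spec (Gam p q \<circ> Coin a1 a2 b)"
  using isolated_if_bounded_below_mod_compact
    finite_span_kernel_mod_compact[OF T.bounded_linear_axioms]
  by (auto simp: ess_spec_iff finite_multiplicity_def)

end

section \<open>Constant coins\<close>

lemma exists_kernel_vector_2x2:
  fixes A B C D :: complex
  assumes "A * D - B * C = 0"
  obtains v :: "complex \<times> complex"
  where "norm v = 1" "A * fst v + B * snd v = 0" "C * fst v + D * snd v = 0"
proof -
  define M :: "complex^2^2" where "M = vector [vector [A, B], vector [C, D]]"
  have "det M = 0" using assms by (simp add: M_def det_2)
  then have "\<not> (\<forall>x. M *v x = 0 \<longrightarrow> x = 0)"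
    using invertible_det_nz invertible_left_inverse matrix_left_invertible_ker by metis
  then obtain x where x: "x \<noteq> 0" "M *v x = 0" by blast
  define v where "v = (x $ 1, x $ 2)"
  have "v \<noteq> 0" using x(1) by (simp add: v_def vec_eq_iff forall_2 zero_prod_def)
  have kernel: "A * fst v + B * snd v = 0" "C * fst v + D * snd v = 0"
    using x(2) by (simp_all add: v_def M_def vec_eq_iff forall_2 matrix_vector_mult_def sum_2)
  have scale: "a * fst (r *\<^sub>R v) + b * snd (r *\<^sub>R v) = r *\<^sub>R (a * fst v + b * snd v)" for a b r
    by (simp add: scaleR_add_right)
  show thesis
  proof (rule that[of "(1 / norm v) *\<^sub>R v"])
    show "norm ((1 / norm v) *\<^sub>R v) = 1" using \<open>v \<noteq> 0\<close> by simp
  qed (simp_all only: scale kernel scaleR_zero_right)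
qed

locale constant_walk = walk p q "\<lambda>_. A1" "\<lambda>_. A2" "\<lambda>_. B"
  for p :: real and q :: complex and A1 A2 :: real and B :: complex
begin

lemma traceless_if_nontrivial:
  assumes "\<not> trivial_coin A1 A2 B"
  shows "A2 = - A1"
proof (cases "B = 0")
  case True
  then have "A1\<^sup>2 = 1" "A2\<^sup>2 = 1" using norm_row1 norm_row2 by simp_all
  then show ?thesis using assms True by (auto simp: trivial_coin_def power2_eq_1_iff)
next
  case False
  then have "complex_of_real (A1 + A2) = 0" using rows_orthogonal by simp
  then show ?thesis unfolding of_real_eq_0_iff by simp
qed

lemma bounded_below_if_anticommutator:
  assumes z: "cmod z = 1"
    and c_pos: "c > 0" and ge: "\<And>\<psi>. c * norm \<psi> \<le> norm (step \<psi> + step_inv \<psi> - (2 * Re z) *\<^sub>R \<psi>)"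
  shows "bounded_below (T z)"
proof (rule bounded_belowI)
  show "c / 2 * norm \<psi> \<le> norm (T z \<psi>)" for \<psi>
  proof -
    have "c * norm \<psi> \<le> norm (T (cnj z) (T z \<psi>))"
      using ge[of \<psi>] T_T_eq[of 1 "cnj z" \<psi>] z by simp
    then show ?thesis using norm_T_le[of "cnj z" "T z \<psi>"] z by simp
  qed
qed (use c_pos in simp)

lemma anticommutator_eq:
  assumes "A2 = - A1"
  shows "step \<psi> + step_inv \<psi>
    = (2 * (p * A1)) *\<^sub>R \<psi>
      + (scaleC (q * B) (translate 1 \<psi>) + scaleC (cnj (q * B)) (translate (- 1) \<psi>))"
proof (rule ell2_eqI)
  fix x
  obtain u v where uv: "app \<psi> x = (u, v)" by fastforce
  obtain u1 v1 where uv1: "app \<psi> (x + 1) = (u1, v1)" by fastforce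
  obtain u2 v2 where uv2: "app \<psi> (x - 1) = (u2, v2)" by fastforce
  show "app (step \<psi> + step_inv \<psi>) x
    = app ((2 * (p * A1)) *\<^sub>R \<psi>
        + (scaleC (q * B) (translate 1 \<psi>) + scaleC (cnj (q * B)) (translate (- 1) \<psi>))) x"
    unfolding app_simps app_scaleC translate.rep_eq app_step app_step_inv Gam_def Coin_def
      csmult_def
    by (simp add: assms uv uv1 uv2 scaleR_conv_of_real) (simp add: algebra_simps)
qed

lemma bounded_below_off_band:
  assumes z: "cmod z = 1" and Re_z: "Re z \<notin> I_set p q A1 A2 B"
  shows "bounded_below (T z)"
proof (cases "trivial_coin A1 A2 B")
  case True
  have "step_inv \<psi> = step \<psi>" for \<psi>
    by (rule ell2_eqI, unfold app_step app_step_inv Gam_def Coin_def)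
      (use True in \<open>auto simp: trivial_coin_def\<close>)
  then have "step \<psi> + step_inv \<psi> - (2 * Re z) *\<^sub>R \<psi> = 2 *\<^sub>R step \<psi> - (2 * Re z) *\<^sub>R \<psi>" for \<psi>
    by (simp add: scaleR_2)
  then have "(2 - 2 * \<bar>Re z\<bar>) * norm \<psi> \<le> norm (step \<psi> + step_inv \<psi> - (2 * Re z) *\<^sub>R \<psi>)" for \<psi>
    using norm_triangle_ineq2[of "2 *\<^sub>R step \<psi>" "(2 * Re z) *\<^sub>R \<psi>"]
    by (simp add: abs_mult left_diff_distrib)
  moreover have "2 - 2 * \<bar>Re z\<bar> > 0"
    using Re_z True abs_Re_le_cmod[of z] z by (auto simp: I_set_def)
  ultimately show ?thesis by (intro bounded_below_if_anticommutator[OF z])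
next
  case False
  define c where "c = 2 * \<bar>p * A1 - Re z\<bar> - 2 * cmod (q * B)"
  have "c * norm \<psi> \<le> norm (step \<psi> + step_inv \<psi> - (2 * Re z) *\<^sub>R \<psi>)" for \<psi>
  proof -
    define \<eta> where "\<eta> = scaleC (q * B) (translate 1 \<psi>) + scaleC (cnj (q * B)) (translate (- 1) \<psi>)"
    have "norm \<eta> \<le> 2 * cmod (q * B) * norm \<psi>"
      unfolding \<eta>_def
      by (rule order_trans[OF norm_triangle_ineq]) (simp add: norm_mult norm_translate)
    moreover have split: "step \<psi> + step_inv \<psi> - (2 * Re z) *\<^sub>R \<psi> = (2 * (p * A1 - Re z)) *\<^sub>R \<psi> + \<eta>"
      unfolding anticommutator_eq[OF traceless_if_nontrivial[OF False]] \<eta>_def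
      by (simp add: algebra_simps)
    moreover have "norm ((2 * (p * A1 - Re z)) *\<^sub>R \<psi>) = 2 * \<bar>p * A1 - Re z\<bar> * norm \<psi>"
      unfolding norm_scaleR abs_mult by simp
    ultimately show ?thesis
      unfolding split c_def left_diff_distrib
      using norm_diff_ineq[of "(2 * (p * A1 - Re z)) *\<^sub>R \<psi>" \<eta>] by linarith
  qed
  moreover have "c > 0" using Re_z False by (auto simp: I_set_def c_def)
  ultimately show ?thesis by (intro bounded_below_if_anticommutator[OF z])
qed

text \<open>On plane waves \<open>\<omega>\<^sup>x v\<close> the walk acts as a \<open>2 \<times> 2\<close> matrix whose characteristic polynomial is
  \<open>X\<^sup>2 - (p A1 - p A2 + 2 Re (q B \<omega>)) X - (A1 A2 - |B|\<^sup>2)\<close>.\<close>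

lemma exists_characteristic_root:
  fixes z :: complex
  assumes z: "cmod z = 1" and Re_z: "Re z \<in> I_set p q A1 A2 B"
  obtains \<omega> where "cmod \<omega> = 1"
    "z * z - (p * A1 - p * A2 + 2 * Re (q * B * \<omega>)) * z - (A1 * A2 - B * cnj B) = 0"
proof (cases "trivial_coin A1 A2 B")
  case True
  have Re_sq: "(Re z)\<^sup>2 = 1" using Re_z True by (auto simp: I_set_def)
  then have "Im z = 0" using cmod_power2[of z] z by simp
  then have "z * z = 1" using Re_sq by (simp add: complex_eq_iff power2_eq_square)
  then show thesis using that[of 1] True by (auto simp: trivial_coin_def)
next
  case False
  have A2: "A2 = - A1" by (rule traceless_if_nontrivial[OF False])
  have "\<bar>Re z - p * A1\<bar> \<le> cmod (q * B)" using Re_z False by (auto simp: I_set_def)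
  then obtain \<omega> where \<omega>: "cmod \<omega> = 1" "Re (q * B * \<omega>) = Re z - p * A1" by (rule exists_unit_with_Re)
  have row: "of_real A1 * of_real A1 + B * cnj B = (1::complex)"
    using arg_cong[OF norm_row1, of complex_of_real] unfolding of_real_add complex_norm_square
    by (simp add: power2_eq_square)
  have "complex_of_real (p * A1 - p * A2 + 2 * Re (q * B * \<omega>)) = z + cnj z"
    unfolding \<omega>(2) A2 complex_add_cnj by simp
  then have "z * z - (p * A1 - p * A2 + 2 * Re (q * B * \<omega>)) * z - (A1 * A2 - B * cnj B)
      = of_real A1 * of_real A1 + B * cnj B - z * cnj z"
    by (simp add: A2 algebra_simps)
  also have "\<dots> = 0" unfolding row using z by (simp add: complex_norm_square[symmetric])
  finally show thesis using that \<omega>(1) by simp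
qed

lemma exists_symbol_kernel:
  fixes z :: complex
  assumes \<omega>: "cmod \<omega> = 1"
    and root: "z * z - (p * A1 - p * A2 + 2 * Re (q * B * \<omega>)) * z - (A1 * A2 - B * cnj B) = 0"
  obtains v :: "complex \<times> complex" where "norm v = 1"
    "(p * A1 + q * \<omega> * B - z) * fst v + (p * cnj B + q * \<omega> * A2) * snd v = 0"
    "(cnj q * cnj \<omega> * A1 - p * B) * fst v + (cnj q * cnj \<omega> * cnj B - p * A2 - z) * snd v = 0"
proof -
  have p_q: "of_real p * of_real p + q * cnj q = (1::complex)"
    using arg_cong[OF norm_p_q, of complex_of_real] unfolding of_real_add complex_norm_square
    by (simp add: power2_eq_square)
  have \<omega>_unit: "\<omega> * cnj \<omega> = 1" using \<omega> by (simp add: complex_norm_square[symmetric])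
  have trace: "q * \<omega> * B + cnj q * cnj \<omega> * cnj B = of_real (2 * Re (q * B * \<omega>))"
    using complex_add_cnj[of "q * B * \<omega>"] by (simp add: ac_simps)
  have "(p * A1 + q * \<omega> * B - z) * (cnj q * cnj \<omega> * cnj B - p * A2 - z)
      - (p * cnj B + q * \<omega> * A2) * (cnj q * cnj \<omega> * A1 - p * B)
    = z * z - (p * A1 - p * A2 + (q * \<omega> * B + cnj q * cnj \<omega> * cnj B)) * z
      - (of_real p * of_real p + q * cnj q * (\<omega> * cnj \<omega>)) * (A1 * A2 - B * cnj B)"
    by (simp add: algebra_simps)
  also have "\<dots> = 0" unfolding \<omega>_unit trace mult_1_right p_q using root by simp
  finally show thesis using that by (rule exists_kernel_vector_2x2)
qed

lemma exists_plane_wave: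
  assumes z: "cmod z = 1" and Re_z: "Re z \<in> I_set p q A1 A2 B"
  obtains \<phi> :: state where "\<And>x. norm (\<phi> x) = 1"
    "Gam p q (Coin (\<lambda>_. A1) (\<lambda>_. A2) (\<lambda>_. B) \<phi>) = (\<lambda>x. csmult z (\<phi> x))"
proof -
  obtain \<omega> where \<omega>: "cmod \<omega> = 1"
    and root: "z * z - (p * A1 - p * A2 + 2 * Re (q * B * \<omega>)) * z - (A1 * A2 - B * cnj B) = 0"
    by (rule exists_characteristic_root[OF assms])
  obtain v where v: "norm v = 1"
    "(p * A1 + q * \<omega> * B - z) * fst v + (p * cnj B + q * \<omega> * A2) * snd v = 0"
    "(cnj q * cnj \<omega> * A1 - p * B) * fst v + (cnj q * cnj \<omega> * cnj B - p * A2 - z) * snd v = 0"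
    by (rule exists_symbol_kernel[OF \<omega> root])
  define \<phi> where "\<phi> x = csmult (\<omega> powi x) v" for x
  have "\<omega> * cnj \<omega> = 1" using \<omega> by (simp add: complex_norm_square[symmetric])
  then have "\<omega> \<noteq> 0" "inverse \<omega> = cnj \<omega>" by (auto intro: inverse_unique)
  then have shift: "\<omega> powi (x + 1) = \<omega> powi x * \<omega>" "\<omega> powi (x - 1) = \<omega> powi x * cnj \<omega>" for x
    by (simp_all add: power_int_add power_int_diff divide_inverse)
  have "Gam p q (Coin (\<lambda>_. A1) (\<lambda>_. A2) (\<lambda>_. B) \<phi>) x - csmult z (\<phi> x)
    = (\<omega> powi x * ((p * A1 + q * \<omega> * B - z) * fst v + (p * cnj B + q * \<omega> * A2) * snd v),
       \<omega> powi x * ((cnj q * cnj \<omega> * A1 - p * B) * fst v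
         + (cnj q * cnj \<omega> * cnj B - p * A2 - z) * snd v))" for x
    unfolding Gam_def Coin_def \<phi>_def csmult_def fst_conv snd_conv shift
    by (simp add: algebra_simps)
  then have "Gam p q (Coin (\<lambda>_. A1) (\<lambda>_. A2) (\<lambda>_. B) \<phi>) = (\<lambda>x. csmult z (\<phi> x))"
    unfolding v(2,3) by (auto simp: fun_eq_iff simp flip: zero_prod_def)
  moreover have "norm (\<phi> x) = 1" for x by (simp add: \<phi>_def norm_csmult norm_power_int \<omega> v(1))
  ultimately show thesis using that by blast
qed

end

section \<open>Truncated states\<close>

context walk
begin

lemma T_truncated_eigenfunction:
  fixes m :: int and n :: nat
  assumes eigen: "Gam p q (Coin a1 a2 b \<phi>) = (\<lambda>x. csmult z (\<phi> x))"
  defines "\<psi> \<equiv> cut {m..<m + int n} \<phi>"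
  shows "T z \<psi> = cut ({m - 1..m} \<union> {m + int n - 1..m + int n})
    (app (T z (cut ({m - 2..m + 1} \<union> {m + int n - 2..m + int n + 1}) (app \<psi>))))"
    (is "_ = cut ?E (app (T z (cut ?N _)))")
proof (rule ell2_eqI)
  have \<psi>: "app \<psi> x = (if x \<in> {m..<m + int n} then \<phi> x else 0)" for x
    by (simp add: \<psi>_def app_cut_finite)
  fix x
  consider (edge) "x \<in> ?E" | (inside) "x \<notin> ?E" "\<And>y. \<bar>y - x\<bar> \<le> 1 \<Longrightarrow> y \<in> {m..<m + int n}"
    | (outside) "x \<notin> ?E" "\<And>y. \<bar>y - x\<bar> \<le> 1 \<Longrightarrow> y \<notin> {m..<m + int n}"
    by force
  then show "app (T z \<psi>) x = app (cut ?E (app (T z (cut ?N (app \<psi>))))) x"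
  proof cases
    case edge
    then have "app (T z \<psi>) x = app (T z (cut ?N (app \<psi>))) x"
      by (intro app_T_local) auto
    then show ?thesis using edge by simp
  next
    case inside
    then have "app \<psi> (x - 1) = \<phi> (x - 1)" "app \<psi> x = \<phi> x" "app \<psi> (x + 1) = \<phi> (x + 1)"
      unfolding \<psi> by (auto simp del: atLeastLessThan_iff)
    then have "app (T z \<psi>) x = Gam p q (Coin a1 a2 b \<phi>) x - csmult z (\<phi> x)"
      by (simp add: app_T Gam_def Coin_def)
    then show ?thesis using inside(1) by (auto simp: eigen)
  next
    case outside
    then have "app (T z \<psi>) x = app (T z 0) x"
      by (intro app_T_local) (auto simp: \<psi> simp del: atLeastLessThan_iff)
    then show ?thesis using outside(1) by (auto simp: T.zero)
  qed
qed

lemma norm_T_truncated_eigenfunction_le: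
  assumes eigen: "Gam p q (Coin a1 a2 b \<phi>) = (\<lambda>x. csmult z (\<phi> x))"
    and unit: "\<And>x. norm (\<phi> x) = 1" and z: "cmod z = 1"
  shows "norm (T z (cut {m..<m + int n} \<phi>)) \<le> 6"
proof -
  define \<psi> where "\<psi> = cut {m..<m + int n} \<phi>"
  define N where "N = {m - 2..m + 1} \<union> {m + int n - 2..m + int n + 1}"
  have "norm (T z \<psi>) \<le> norm (T z (cut N (app \<psi>)))"
    using T_truncated_eigenfunction[OF eigen, of m n] norm_cut_le by (metis \<psi>_def N_def)
  also have "\<dots> \<le> 2 * norm (cut N (app \<psi>))" using norm_T_le[of z] z by simp
  also have "norm (cut N (app \<psi>)) \<le> norm (cut N \<phi>)"
    using norm_ell2_dominated[of "cut N (app \<psi>)" 1 "cut N \<phi>"]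
    by (auto simp: \<psi>_def N_def app_cut_finite)
  also have "norm (cut N \<phi>) \<le> 3"
  proof -
    have "card N \<le> 9"
      using card_Un_le[of "{m - 2..m + 1}" "{m + int n - 2..m + int n + 1}"] by (simp add: N_def)
    then have "sqrt (card N) \<le> 3" by (intro real_le_lsqrt) auto
    then show ?thesis using norm_cut_unit[of N \<phi>] unit by (simp add: N_def)
  qed
  finally show ?thesis by (simp add: \<psi>_def)
qed

definition bounded_below_along :: "int filter \<Rightarrow> complex \<Rightarrow> bool" where
  "bounded_below_along F z \<longleftrightarrow> (\<exists>c>0. \<exists>S. eventually (\<lambda>x. x \<in> S) F
    \<and> (\<forall>\<psi>. (\<forall>x. app \<psi> x \<noteq> 0 \<longrightarrow> x \<in> S) \<longrightarrow> c * norm \<psi> \<le> norm (T z \<psi>)))"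

lemma norm_cut_le_norm_T:
  assumes bound: "\<And>\<phi>. (\<forall>x. app \<phi> x \<noteq> 0 \<longrightarrow> x \<in> A) \<Longrightarrow> c * norm \<phi> \<le> norm (T z \<phi>)"
    and "\<And>x. app \<psi> x \<noteq> 0 \<Longrightarrow> x \<in> S \<Longrightarrow> x \<in> A"
    and no_boundary: "\<And>x y. app \<psi> x \<noteq> 0 \<Longrightarrow> \<bar>x - y\<bar> \<le> 1 \<Longrightarrow> x \<in> S \<longleftrightarrow> y \<in> S"
  shows "c * norm (cut S (app \<psi>)) \<le> norm (T z \<psi>)"
proof -
  have "c * norm (cut S (app \<psi>)) \<le> norm (T z (cut S (app \<psi>)))" using assms(2) by (intro bound) auto
  also have "\<dots> = norm (cut S (app (T z \<psi>)))" by (simp add: T_cut[OF no_boundary])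
  also have "\<dots> \<le> norm (T z \<psi>)" by (rule norm_cut_le)
  finally show ?thesis .
qed

text \<open>If \<open>\<psi>\<close> vanishes near the origin, then its left and right halves do not interact under \<open>T z\<close>.\<close>

lemma bounded_below_off_box:
  assumes "bounded_below_along at_bot z" "bounded_below_along at_top z"
  obtains c N where "c > 0" "\<And>\<psi>. (\<And>x. x \<in> {- N..N} \<Longrightarrow> app \<psi> x = 0) \<Longrightarrow> c * norm \<psi> \<le> norm (T z \<psi>)"
proof -
  obtain cL SL where cL_pos: "cL > 0" and "eventually (\<lambda>x. x \<in> SL) at_bot"
    and boundL: "\<And>\<psi>. (\<forall>x. app \<psi> x \<noteq> 0 \<longrightarrow> x \<in> SL) \<Longrightarrow> cL * norm \<psi> \<le> norm (T z \<psi>)"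
    using assms(1) unfolding bounded_below_along_def by blast
  moreover obtain cR SR where cR_pos: "cR > 0" and "eventually (\<lambda>x. x \<in> SR) at_top"
    and boundR: "\<And>\<psi>. (\<forall>x. app \<psi> x \<noteq> 0 \<longrightarrow> x \<in> SR) \<Longrightarrow> cR * norm \<psi> \<le> norm (T z \<psi>)"
    using assms(2) unfolding bounded_below_along_def by blast
  ultimately obtain NL NR where SL: "\<And>x. x \<le> NL \<Longrightarrow> x \<in> SL" and SR: "\<And>x. x \<ge> NR \<Longrightarrow> x \<in> SR"
    unfolding eventually_at_bot_linorder eventually_at_top_linorder by blast
  define N where "N = max 1 (max \<bar>NL\<bar> \<bar>NR\<bar>)"
  define c where "c = min cL cR"
  have c_pos: "c > 0" using cL_pos cR_pos by (simp add: c_def)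
  have "c / 2 * norm \<psi> \<le> norm (T z \<psi>)" if zero: "\<And>x. x \<in> {- N..N} \<Longrightarrow> app \<psi> x = 0" for \<psi>
  proof -
    define \<psi>L \<psi>R where "\<psi>L = cut {..<0} (app \<psi>)" and "\<psi>R = cut {0..} (app \<psi>)"
    have supp: "x < - N \<or> N < x" if "app \<psi> x \<noteq> 0" for x using zero[of x] that by force
    have "N \<ge> 1" by (simp add: N_def)
    have "c * norm \<psi>L \<le> cL * norm \<psi>L" "c * norm \<psi>R \<le> cR * norm \<psi>R"
      by (auto simp: c_def intro: mult_right_mono)
    moreover have "cL * norm \<psi>L \<le> norm (T z \<psi>)"
      unfolding \<psi>L_def using SL \<open>N \<ge> 1\<close>
      by (intro norm_cut_le_norm_T[OF boundL]) (auto simp: N_def dest!: supp)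
    moreover have "cR * norm \<psi>R \<le> norm (T z \<psi>)"
      unfolding \<psi>R_def using SR \<open>N \<ge> 1\<close>
      by (intro norm_cut_le_norm_T[OF boundR]) (auto simp: N_def dest!: supp)
    moreover have "c * norm \<psi> \<le> c * (norm \<psi>L + norm \<psi>R)"
    proof (rule mult_left_mono)
      have "\<psi> = \<psi>L + \<psi>R" by (rule ell2_eqI) (auto simp: \<psi>L_def \<psi>R_def)
      then show "norm \<psi> \<le> norm \<psi>L + norm \<psi>R" using norm_triangle_ineq by blast
    qed (use c_pos in simp)
    ultimately show ?thesis by (simp add: distrib_left)
  qed
  then show thesis using that[of "c / 2" N] c_pos by simp
qed

lemma bounded_below_mod_compact_if_along_both_ends:
  assumes "bounded_below_along at_bot z" "bounded_below_along at_top z"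
  shows "bounded_below_mod_compact (T z)"
proof -
  obtain c N where c_pos: "c > 0"
    and bound: "\<And>\<psi>. (\<And>x. x \<in> {- N..N} \<Longrightarrow> app \<psi> x = 0) \<Longrightarrow> c * norm \<psi> \<le> norm (T z \<psi>)"
    by (rule bounded_below_off_box[OF assms]) blast
  define K where "K \<psi> = cut {- N..N} (app \<psi>)" for \<psi> :: wave
  define C where "C = 1 / c + (1 + cmod z) / c + 1"
  have "norm \<psi> \<le> C * (norm (T z \<psi>) + norm (K \<psi>))" for \<psi>
  proof -
    have "c * norm (\<psi> - K \<psi>) \<le> norm (T z (\<psi> - K \<psi>))" by (rule bound) (simp add: K_def)
    also have "\<dots> \<le> norm (T z \<psi>) + (1 + cmod z) * norm (K \<psi>)"
      unfolding T.diff by (intro order_trans[OF norm_triangle_ineq4] add_left_mono norm_T_le)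
    finally have "norm (\<psi> - K \<psi>) \<le> (norm (T z \<psi>) + (1 + cmod z) * norm (K \<psi>)) / c"
      using c_pos by (simp add: pos_le_divide_eq mult.commute)
    then have "norm \<psi> \<le> 1 / c * norm (T z \<psi>) + ((1 + cmod z) / c + 1) * norm (K \<psi>)"
      using norm_triangle_ineq[of "\<psi> - K \<psi>" "K \<psi>"] by (simp add: distrib_right add_divide_distrib)
    also have "\<dots> \<le> C * norm (T z \<psi>) + C * norm (K \<psi>)"
      using c_pos by (intro add_mono mult_right_mono) (auto simp: C_def)
    finally show ?thesis by (simp add: distrib_left)
  qed
  moreover have "compact_operator K" unfolding K_def by (rule compact_operator_cut) simp
  ultimately show ?thesis unfolding bounded_below_mod_compact_def by blast
qed

lemma constant_walk_if_tendsto: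
  assumes "F \<noteq> bot" and lim: "(a1 \<longlongrightarrow> A1) F" "(a2 \<longlongrightarrow> A2) F" "(b \<longlongrightarrow> B) F"
  shows "constant_walk p q A1 A2 B"
proof -
  have "((\<lambda>x. (a1 x)\<^sup>2 + (norm (b x))\<^sup>2) \<longlongrightarrow> A1\<^sup>2 + (norm B)\<^sup>2) F"
    "((\<lambda>x. (a2 x)\<^sup>2 + (norm (b x))\<^sup>2) \<longlongrightarrow> A2\<^sup>2 + (norm B)\<^sup>2) F"
    "((\<lambda>x. b x * complex_of_real (a1 x + a2 x)) \<longlongrightarrow> B * complex_of_real (A1 + A2)) F"
    by (intro tendsto_intros lim)+
  then have "A1\<^sup>2 + (norm B)\<^sup>2 = 1" "A2\<^sup>2 + (norm B)\<^sup>2 = 1" "B * complex_of_real (A1 + A2) = 0"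
    unfolding norm_row1 norm_row2 rows_orthogonal by (simp_all only: tendsto_const_iff[OF assms(1)])
  then show ?thesis using norm_p_q by unfold_locales
qed

end

section \<open>Walks with a limit coin\<close>

lemma norm_Coin_diff_le:
  "norm (Coin a1 a2 b \<psi> x - Coin a1' a2' b' \<psi> x)
    \<le> (\<bar>a1 x - a1' x\<bar> + \<bar>a2 x - a2' x\<bar> + 2 * cmod (b x - b' x)) * norm (\<psi> x)"
proof -
  define u v where "u = fst (\<psi> x)" and "v = snd (\<psi> x)"
  have uv: "cmod u \<le> norm (\<psi> x)" "cmod v \<le> norm (\<psi> x)"
    unfolding u_def v_def by (metis norm_fst_le norm_snd_le prod.collapse)+
  have "Coin a1 a2 b \<psi> x - Coin a1' a2' b' \<psi> x
      = (of_real (a1 x - a1' x) * u + cnj (b x - b' x) * v,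
         (b x - b' x) * u + of_real (a2 x - a2' x) * v)"
    by (simp add: Coin_def u_def v_def algebra_simps)
  also have "norm \<dots> \<le> norm (of_real (a1 x - a1' x) * u + cnj (b x - b' x) * v)
      + norm ((b x - b' x) * u + of_real (a2 x - a2' x) * v)"
    by (rule norm_Pair_le)
  also have "\<dots> \<le> (\<bar>a1 x - a1' x\<bar> * cmod u + cmod (b x - b' x) * cmod v)
      + (cmod (b x - b' x) * cmod u + \<bar>a2 x - a2' x\<bar> * cmod v)"
    by (intro add_mono order_trans[OF norm_triangle_ineq])
      (simp_all only: norm_mult norm_of_real complex_mod_cnj order_refl)
  also have "\<dots> \<le> (\<bar>a1 x - a1' x\<bar> * norm (\<psi> x) + cmod (b x - b' x) * norm (\<psi> x))
      + (cmod (b x - b' x) * norm (\<psi> x) + \<bar>a2 x - a2' x\<bar> * norm (\<psi> x))"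
    by (intro add_mono mult_left_mono uv) auto
  finally show ?thesis by (simp add: algebra_simps)
qed

lemma eventually_imp_block:
  fixes F :: "int filter" and n :: nat
  assumes F: "F = at_bot \<or> F = at_top" and P: "eventually P F"
  shows "\<exists>m. \<forall>x\<in>{m..<m + int n}. P x"
proof (cases "F = at_top")
  case True
  then obtain m where "\<forall>x\<ge>m. P x" using P by (auto simp: eventually_at_top_linorder)
  then show ?thesis by (intro exI[of _ m]) simp
next
  case False
  then obtain m where "\<forall>x\<le>m. P x" using F P by (auto simp: eventually_at_bot_linorder)
  then show ?thesis by (intro exI[of _ "m - int n"]) simp
qed

locale walk_with_limit = walk p q a1 a2 b + limit: constant_walk p q A1 A2 B
  for p :: real and q :: complex and a1 a2 :: "int \<Rightarrow> real" and b :: "int \<Rightarrow> complex"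
    and A1 A2 :: real and B :: complex +
  fixes F :: "int filter"
  assumes tendsto: "(a1 \<longlongrightarrow> A1) F" "(a2 \<longlongrightarrow> A2) F" "(b \<longlongrightarrow> B) F"
begin

definition coin_dist :: "int \<Rightarrow> real" where
  "coin_dist x = \<bar>a1 x - A1\<bar> + \<bar>a2 x - A2\<bar> + 2 * cmod (b x - B)"

lemma eventually_coin_dist_le:
  assumes "d > 0"
  shows "eventually (\<lambda>x. coin_dist x \<le> d) F"
proof -
  have "(coin_dist \<longlongrightarrow> \<bar>A1 - A1\<bar> + \<bar>A2 - A2\<bar> + 2 * cmod (B - B)) F"
    unfolding coin_dist_def[abs_def] by (intro tendsto_intros tendsto)
  then have "eventually (\<lambda>x. coin_dist x < d) F" using assms by (intro order_tendstoD(2)) auto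
  then show ?thesis by eventually_elim simp
qed

lemma norm_T_diff_limit_le:
  assumes d_nonneg: "d \<ge> 0" and close: "\<And>x. app \<psi> x \<noteq> 0 \<Longrightarrow> coin_dist x \<le> d"
  shows "norm (T z \<psi> - limit.T z \<psi>) \<le> d * norm \<psi>"
proof -
  have "T z \<psi> - limit.T z \<psi>
      = shift_op p q (coin_op a1 a2 b \<psi> - coin_op (\<lambda>_. A1) (\<lambda>_. A2) (\<lambda>_. B) \<psi>)"
    by (simp add: T_def limit.T_def step_def limit.step_def shift_op_diff)
  then have "norm (T z \<psi> - limit.T z \<psi>)
      = norm (coin_op a1 a2 b \<psi> - coin_op (\<lambda>_. A1) (\<lambda>_. A2) (\<lambda>_. B) \<psi>)"
    by (simp add: norm_shift_op)
  also have "\<dots> \<le> d * norm \<psi>"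
  proof (rule norm_ell2_dominated[OF _ d_nonneg])
    fix x
    have "norm (app (coin_op a1 a2 b \<psi> - coin_op (\<lambda>_. A1) (\<lambda>_. A2) (\<lambda>_. B) \<psi>) x)
        \<le> coin_dist x * norm (app \<psi> x)"
      using norm_Coin_diff_le[of a1 a2 b "app \<psi>" x "\<lambda>_. A1" "\<lambda>_. A2" "\<lambda>_. B"]
      by (simp add: app_coin_op limit.app_coin_op coin_dist_def)
    also have "\<dots> \<le> d * norm (app \<psi> x)"
      using close[of x] by (cases "app \<psi> x = 0") (auto intro: mult_right_mono)
    finally show "norm (app (coin_op a1 a2 b \<psi> - coin_op (\<lambda>_. A1) (\<lambda>_. A2) (\<lambda>_. B) \<psi>) x)
        \<le> d * norm (app \<psi> x)" .
  qed
  finally show ?thesis .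
qed

lemma bounded_below_along_limit:
  assumes "bounded_below (limit.T z)"
  shows "bounded_below_along F z"
proof -
  obtain c where c_pos: "c > 0" and limit_ge: "\<And>\<psi>. c * norm \<psi> \<le> norm (limit.T z \<psi>)"
    using assms unfolding bounded_below_def by blast
  show ?thesis
    unfolding bounded_below_along_def
  proof (intro exI conjI allI impI)
    show "c / 2 > 0" using c_pos by simp
    then show "eventually (\<lambda>x. x \<in> {x. coin_dist x \<le> c / 2}) F"
      unfolding mem_Collect_eq by (rule eventually_coin_dist_le)
    fix \<psi> :: wave assume "\<forall>x. app \<psi> x \<noteq> 0 \<longrightarrow> x \<in> {x. coin_dist x \<le> c / 2}"
    then have "norm (T z \<psi> - limit.T z \<psi>) \<le> c / 2 * norm \<psi>"
      using c_pos by (intro norm_T_diff_limit_le) auto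
    then show "c / 2 * norm \<psi> \<le> norm (T z \<psi>)"
      using limit_ge[of \<psi>] norm_triangle_sub[of "limit.T z \<psi>" "T z \<psi>"]
      by (simp add: norm_minus_commute)
  qed
qed

lemma exists_far_block:
  assumes F: "F = at_bot \<or> F = at_top"
  shows "\<exists>m. \<forall>x\<in>{m..<m + int l}. int n < \<bar>x\<bar> \<and> coin_dist x \<le> 1 / Suc n"
proof (rule eventually_imp_block[OF F])
  have "eventually (\<lambda>x. int n < \<bar>x\<bar>) at_bot" "eventually (\<lambda>x. int n < \<bar>x\<bar>) at_top"
    unfolding eventually_at_bot_linorder eventually_at_top_linorder
    by (auto intro: exI[of _ "- int n - 1"] exI[of _ "int n + 1"])
  then show "eventually (\<lambda>x. int n < \<bar>x\<bar> \<and> coin_dist x \<le> 1 / Suc n) F"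
    using F by (intro eventually_conj eventually_coin_dist_le) auto
qed

lemma norm_T_far_plane_wave_le:
  assumes eigen: "Gam p q (Coin (\<lambda>_. A1) (\<lambda>_. A2) (\<lambda>_. B) \<phi>) = (\<lambda>x. csmult z (\<phi> x))"
    and unit: "\<And>x. norm (\<phi> x) = 1" and z: "cmod z = 1"
    and close: "\<And>x. x \<in> {m..<m + int ((Suc n)\<^sup>2)} \<Longrightarrow> coin_dist x \<le> 1 / Suc n"
  shows "norm (T z (cut {m..<m + int ((Suc n)\<^sup>2)} \<phi>)) \<le> 7"
proof -
  define \<psi> where "\<psi> = cut {m..<m + int ((Suc n)\<^sup>2)} \<phi>"
  have "norm (T z \<psi> - limit.T z \<psi>) \<le> 1 / Suc n * norm \<psi>"
    using close by (intro norm_T_diff_limit_le) (auto simp: \<psi>_def app_cut_finite split: if_splits)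
  also have "\<dots> = 1" using norm_cut_unit[of "{m..<m + int ((Suc n)\<^sup>2)}" \<phi>] unit by (simp add: \<psi>_def)
  finally show ?thesis
    using limit.norm_T_truncated_eigenfunction_le[OF eigen unit z, of m "(Suc n)\<^sup>2"]
      norm_triangle_sub[of "T z \<psi>" "limit.T z \<psi>"] unfolding \<psi>_def by linarith
qed

lemma exists_weyl_sequence:
  assumes F: "F = at_bot \<or> F = at_top" and z: "cmod z = 1" "Re z \<in> I_set p q A1 A2 B"
  shows "\<exists>\<psi>. weyl_sequence z \<psi>"
proof -
  obtain \<phi> where unit: "\<And>x. norm (\<phi> x) = 1"
    and eigen: "Gam p q (Coin (\<lambda>_. A1) (\<lambda>_. A2) (\<lambda>_. B) \<phi>) = (\<lambda>x. csmult z (\<phi> x))"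
    by (rule limit.exists_plane_wave[OF z]) blast
  have "\<exists>m. \<forall>n. \<forall>x\<in>{m n..<m n + int ((Suc n)\<^sup>2)}. int n < \<bar>x\<bar> \<and> coin_dist x \<le> 1 / Suc n"
    by (rule choice) (use exists_far_block[OF F] in blast)
  then obtain m where far:
    "\<And>n x. x \<in> {m n..<m n + int ((Suc n)\<^sup>2)} \<Longrightarrow> int n < \<bar>x\<bar> \<and> coin_dist x \<le> 1 / Suc n"
    by blast
  define \<psi> where "\<psi> n = inverse (real (Suc n)) *\<^sub>R cut {m n..<m n + int ((Suc n)\<^sup>2)} \<phi>" for n
  have norm_\<psi>: "norm (\<psi> n) = 1" for n
    using norm_cut_unit[of "{m n..<m n + int ((Suc n)\<^sup>2)}" \<phi>] unit by (simp add: \<psi>_def)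
  have "app (\<psi> n) x = 0" if "n \<ge> nat \<bar>x\<bar>" for n x
    using far[of x n] that by (auto simp: \<psi>_def app_cut_finite)
  then have null: "(\<lambda>n. inner (\<psi> n) \<eta>) \<longlonglongrightarrow> 0" for \<eta>
    by (intro weakly_null_if_locally_zero) (auto simp: norm_\<psi> eventually_sequentially)
  have "norm (T z (\<psi> n)) \<le> 7 * inverse (real (Suc n))" for n
    using mult_right_mono[OF norm_T_far_plane_wave_le[OF eigen unit z(1), of "m n" n],
        of "inverse (real (Suc n))"] far
    by (simp add: \<psi>_def T.scaleR mult.commute)
  then have "(\<lambda>n. T z (\<psi> n)) \<longlonglongrightarrow> 0"
    by (intro Lim_null_comparison[OF always_eventually
          tendsto_mult_right_zero[OF LIMSEQ_inverse_real_of_nat]])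
      blast
  then show ?thesis using norm_\<psi> null unfolding weyl_sequence_def by blast
qed

end

lemma (in constant_walk) spec_eq_band:
  "spec (Gam p q \<circ> Coin (\<lambda>_. A1) (\<lambda>_. A2) (\<lambda>_. B)) = {z. cmod z = 1 \<and> Re z \<in> I_set p q A1 A2 B}"
proof -
  interpret self: walk_with_limit p q "\<lambda>_. A1" "\<lambda>_. A2" "\<lambda>_. B" A1 A2 B at_top
    by unfold_locales auto
  have "\<not> bounded_below (T z)" if "cmod z = 1" "Re z \<in> I_set p q A1 A2 B" for z
    using self.exists_weyl_sequence[of z] that weyl_sequence_imp_not_bounded_below by auto
  then show ?thesis
    unfolding set_eq_iff spec_iff mem_Collect_eq
    using bounded_below_off_band not_bounded_below_imp_norm_1 by blast
qed

lemma (in walk) ess_spec_eq_limit_specs: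
  assumes limL: "(a1 \<longlongrightarrow> a1L) at_bot" "(a2 \<longlongrightarrow> a2L) at_bot" "(b \<longlongrightarrow> bL) at_bot"
    and limR: "(a1 \<longlongrightarrow> a1R) at_top" "(a2 \<longlongrightarrow> a2R) at_top" "(b \<longlongrightarrow> bR) at_top"
  shows "ess_spec (Gam p q \<circ> Coin a1 a2 b)
    = spec (Gam p q \<circ> Coin (\<lambda>_. a1L) (\<lambda>_. a2L) (\<lambda>_. bL))
      \<union> spec (Gam p q \<circ> Coin (\<lambda>_. a1R) (\<lambda>_. a2R) (\<lambda>_. bR))"
proof -
  interpret left: constant_walk p q a1L a2L bL by (rule constant_walk_if_tendsto[OF _ limL]) simp
  interpret right: constant_walk p q a1R a2R bR by (rule constant_walk_if_tendsto[OF _ limR]) simp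
  interpret L: walk_with_limit p q a1 a2 b a1L a2L bL at_bot by unfold_locales (fact limL)+
  interpret R: walk_with_limit p q a1 a2 b a1R a2R bR at_top by unfold_locales (fact limR)+
  have "z \<in> ess_spec (Gam p q \<circ> Coin a1 a2 b)"
    if "z \<in> spec (Gam p q \<circ> Coin (\<lambda>_. a1L) (\<lambda>_. a2L) (\<lambda>_. bL))" for z
    using that L.exists_weyl_sequence[of z] weyl_sequence_imp_ess_spec
    by (auto simp: left.spec_eq_band)
  moreover have "z \<in> ess_spec (Gam p q \<circ> Coin a1 a2 b)"
    if "z \<in> spec (Gam p q \<circ> Coin (\<lambda>_. a1R) (\<lambda>_. a2R) (\<lambda>_. bR))" for z
    using that R.exists_weyl_sequence[of z] weyl_sequence_imp_ess_spec
    by (auto simp: right.spec_eq_band)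
  moreover have "z \<notin> ess_spec (Gam p q \<circ> Coin a1 a2 b)"
    if "bounded_below (left.T z)" "bounded_below (right.T z)" for z
    using that
    by (intro bounded_below_mod_compact_imp_not_ess_spec bounded_below_mod_compact_if_along_both_ends
        L.bounded_below_along_limit R.bounded_below_along_limit)
  ultimately show ?thesis
    unfolding set_eq_iff Un_iff left.spec_iff right.spec_iff by blast
qed

theorem theorem5p2:
  fixes p :: real and q :: complex
    and a1 a2 :: "int \<Rightarrow> real" and b :: "int \<Rightarrow> complex"
    and a1L a2L a1R a2R :: real and bL bR :: complex
  assumes pq: "q \<noteq> 0" "p\<^sup>2 + (norm q)\<^sup>2 = 1"
    and coin1: "\<And>x. (a1 x)\<^sup>2 + (norm (b x))\<^sup>2 = 1"
    and coin2: "\<And>x. (a2 x)\<^sup>2 + (norm (b x))\<^sup>2 = 1"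
    and coin3: "\<And>x. b x * complex_of_real (a1 x + a2 x) = 0"
    and limL: "(a1 \<longlongrightarrow> a1L) at_bot" "(a2 \<longlongrightarrow> a2L) at_bot" "(b \<longlongrightarrow> bL) at_bot"
    and limR: "(a1 \<longlongrightarrow> a1R) at_top" "(a2 \<longlongrightarrow> a2R) at_top" "(b \<longlongrightarrow> bR) at_top"
  shows "ess_spec (Gam p q \<circ> Coin a1 a2 b)
           = spec (Gam p q \<circ> Coin (\<lambda>_. a1L) (\<lambda>_. a2L) (\<lambda>_. bL))
             \<union> spec (Gam p q \<circ> Coin (\<lambda>_. a1R) (\<lambda>_. a2R) (\<lambda>_. bR))
       \<and> spec (Gam p q \<circ> Coin (\<lambda>_. a1L) (\<lambda>_. a2L) (\<lambda>_. bL))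
           = {z. cmod z = 1 \<and> Re z \<in> I_set p q a1L a2L bL}
       \<and> spec (Gam p q \<circ> Coin (\<lambda>_. a1R) (\<lambda>_. a2R) (\<lambda>_. bR))
           = {z. cmod z = 1 \<and> Re z \<in> I_set p q a1R a2R bR}"
proof -
  interpret walk p q a1 a2 b by unfold_locales (fact coin1 coin2 coin3 pq(2))+
  interpret left: constant_walk p q a1L a2L bL by (rule constant_walk_if_tendsto[OF _ limL]) simp
  interpret right: constant_walk p q a1R a2R bR by (rule constant_walk_if_tendsto[OF _ limR]) simp
  show ?thesis
    using ess_spec_eq_limit_specs[OF limL limR] left.spec_eq_band right.spec_eq_band by blast
qed

end
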